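(* Consider a parallel network consisting of $n$ links, with lower and upper bounds on link weights $w^l,w^u\in\mathbb R^n_{>0}$ and link capacities $c\in\mathbb R^n_{>0}$. Then, for every $\lambda\in\mathbb R^n_{>0}$ and $w(0)\in[w^l,w^u]$, we have $$R(u^1)=V^*=\alpha^*$$ if and only if $w(0)\ge w^{\mathrm{opt}}$ (componentwise), where $w^{\mathrm{opt}}_i=\min\{c_i\max_jw_j^l/c_j,\ w_i^u\}$.
   Context: Parallel network: $n$ links from a single supply node to a single demand node, with supply/demand of (post-disturbance) magnitude $\alpha\ge0$; for weights $w>\mathbf 0$ the link flows are $f_i(w)=\alpha w_i/\sum_{j=1}^nw_j$, and $f_i(t)=f_i(w(t))$. Controller $u^1$: $\dot w_i(t)=u^1_i(w_i(t),f_i(t))$ with $u_i^1=-\lambda_i$ if $f_i(t)>c_i$ and $w_i(t)>w_i^l$, and $u_i^1=0$ otherwise; trajectories are continuous and converge (each $w_i(t)$ is nonincreasing and bounded below by $w_i^l$). $R(u^1)$ is the margin of robustness of $u^1$, measured in terms of supply/demand magnitude: the supremum of $\alpha\ge 0$ such that, for every supply/demand magnitude in $[0,\alpha]$, the limiting flow satisfies $\lim_{t\to\infty}f(w(t))\in[0,c]$. $V^*$: let $r_i:=w_i(0)/c_i$, with links labeled so that $r_1\le\dots\le r_n$; $r^*:=\max_iw_i^l/c_i$; $\bar k:=\min\{j:r_j\ge r^*\}$; $V^*:=\frac1{r^*}\sum_{i=1}^{\bar k-1}w_i(0)+\sum_{i=\bar k}^nc_i$. $\alpha^*$ is the optimal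 value of the problem: maximize $\alpha$ over $\alpha\in\mathbb R$, $w\in\mathbb R^n$ subject to $w^l\le w\le w^u$ and $0\le \alpha w_i/\sum_jw_j\le c_i$ for all $i$. Explicitly, $\alpha^*=\frac1{r^*}\sum_{i:\,w_i^u<c_ir^*}w_i^u+\sum_{i:\,w_i^u\ge c_ir^*}c_i$; the vector $w^{\mathrm{opt}}$ is an optimal weight for this problem. *)

theory Defs
  imports "HOL-Analysis.Analysis"
begin

text \<open>
  Links are the elements of a finite type, so the number of links is the cardinality of that
  type; vectors indexed by links are ordered componentwise.
\<close>

definition flow :: "real \<Rightarrow> real^'n \<Rightarrow> real^'n" where
  "flow \<alpha> w = (\<chi> i. \<alpha> * w $ i / (\<Sum>j\<in>UNIV. w $ j))"


section \<open>Solutions of differential equations with discontinuous right-hand side\<close>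

text \<open>
  The controller below is discontinuous. Wherever it drives a link onto the surface on which
  flow equals capacity, the trajectory may have to slide along that surface, and then no
  function satisfies the differential equation literally, not even almost everywhere. Solutions
  are therefore taken in the usual generalised sense: locally absolutely continuous functions
  (written as indefinite Lebesgue integrals) whose velocity lies almost everywhere in the
  Krasovskii regularisation of the right-hand side. Every classical, Caratheodory or Filippov
  solution is a solution in this sense.
\<close>

definition krasovskii :: "('a::euclidean_space \<Rightarrow> 'a) \<Rightarrow> 'a \<Rightarrow> 'a set" where
  "krasovskii X x = (\<Inter>\<delta>\<in>{0<..}. closure (convex hull (X ` ball x \<delta>)))"

definition krasovskii_solution ::
    "('a::euclidean_space \<Rightarrow> 'a) \<Rightarrow> (real \<Rightarrow> 'a) \<Rightarrow> bool" where
  "krasovskii_solution X x \<longleftrightarrow>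
     (\<exists>v. (\<forall>t\<ge>0. v absolutely_integrable_on {0..t} \<and> x t = x 0 + integral {0..t} v) \<and>
          (AE t in lebesgue. 0 \<le> t \<longrightarrow> v t \<in> krasovskii X (x t)))"


section \<open>Decentralised weight control and its margin of robustness\<close>

text \<open>
  A controller \<open>u\<close> assigns to link \<open>i\<close>, its own weight and its own flow the rate of change
  of that weight.
\<close>

definition closed_loop ::
    "('n \<Rightarrow> real \<Rightarrow> real \<Rightarrow> real) \<Rightarrow> real \<Rightarrow> real^'n \<Rightarrow> real^'n" where
  "closed_loop u \<alpha> w = (\<chi> i. u i (w $ i) (flow \<alpha> w $ i))"

text \<open>
  The formula for the flow is meaningful only for positive weights, hence the positivity
  requirement on trajectories.
\<close>

definition trajectory ::
    "('n::finite \<Rightarrow> real \<Rightarrow> real \<Rightarrow> real) \<Rightarrow> real \<Rightarrow> real^'n \<Rightarrow> (real \<Rightarrow> real^'n) \<Rightarrow> bool" where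
  "trajectory u \<alpha> w0 w \<longleftrightarrow>
     w 0 = w0 \<and> (\<forall>t\<ge>0. \<forall>i. 0 < w t $ i) \<and> krasovskii_solution (closed_loop u \<alpha>) w"

definition feasible_limit :: "real^'n \<Rightarrow> real \<Rightarrow> (real \<Rightarrow> real^'n) \<Rightarrow> bool" where
  "feasible_limit c \<alpha> w \<longleftrightarrow>
     (\<exists>L. ((\<lambda>t. flow \<alpha> (w t)) \<longlongrightarrow> L) at_top \<and> 0 \<le> L \<and> L \<le> c)"

definition margin_of_robustness ::
    "('n::finite \<Rightarrow> real \<Rightarrow> real \<Rightarrow> real) \<Rightarrow> real^'n \<Rightarrow> real^'n \<Rightarrow> ereal" where
  "margin_of_robustness u c w0 =
     Sup (ereal ` {\<alpha>. 0 \<le> \<alpha> \<and>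
       (\<forall>\<beta>\<in>{0..\<alpha>}. \<forall>w. trajectory u \<beta> w0 w \<longrightarrow> feasible_limit c \<beta> w)})"

definition u1 ::
    "real^'n \<Rightarrow> real^'n \<Rightarrow> real^'n \<Rightarrow> 'n \<Rightarrow> real \<Rightarrow> real \<Rightarrow> real" where
  "u1 rate c wl i x f = (if c $ i < f \<and> wl $ i < x then - (rate $ i) else 0)"


section \<open>The quantities compared with the margin\<close>

definition r_star :: "real^'n::finite \<Rightarrow> real^'n \<Rightarrow> real" where
  "r_star wl c = Max (range (\<lambda>i. wl $ i / c $ i))"

text \<open>
  A labelling \<open>p\<close> of the links by \<open>1, ..., n\<close> along which the ratios \<open>w0 $ i / c $ i\<close> are
  nondecreasing.
\<close>

definition sorted_labelling :: "real^'n::finite \<Rightarrow> real^'n \<Rightarrow> (nat \<Rightarrow> 'n) \<Rightarrow> bool" where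
  "sorted_labelling w0 c p \<longleftrightarrow>
     bij_betw p {1..CARD('n)} UNIV \<and>
     mono_on {1..CARD('n)} (\<lambda>j. w0 $ p j / c $ p j)"

definition k_bar :: "real^'n::finite \<Rightarrow> real^'n \<Rightarrow> real^'n \<Rightarrow> (nat \<Rightarrow> 'n) \<Rightarrow> nat" where
  "k_bar wl c w0 p = Min {j \<in> {1..CARD('n)}. r_star wl c \<le> w0 $ p j / c $ p j}"

definition V_star :: "real^'n::finite \<Rightarrow> real^'n \<Rightarrow> real^'n \<Rightarrow> (nat \<Rightarrow> 'n) \<Rightarrow> real" where
  "V_star wl c w0 p =
     (1 / r_star wl c) * (\<Sum>i = 1..k_bar wl c w0 p - 1. w0 $ p i) +
     (\<Sum>i = k_bar wl c w0 p..CARD('n). c $ p i)"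

definition alpha_star :: "real^'n::finite \<Rightarrow> real^'n \<Rightarrow> real^'n \<Rightarrow> ereal" where
  "alpha_star wl wu c =
     Sup (ereal ` {\<alpha>. \<exists>w. wl \<le> w \<and> w \<le> wu \<and> 0 \<le> flow \<alpha> w \<and> flow \<alpha> w \<le> c})"

definition w_opt :: "real^'n::finite \<Rightarrow> real^'n \<Rightarrow> real^'n \<Rightarrow> real^'n" where
  "w_opt wl wu c = (\<chi> i. min (c $ i * Max (range (\<lambda>j. wl $ j / c $ j))) (wu $ i))"

end

theory Submission
  imports Defs
begin

text \<open>
  Write \<open>r\<close> for \<open>r_star wl c\<close> and \<open>B u\<close> for the sum over all links of
  \<open>min (u $ i / r) (c $ i)\<close>. The theorem follows from three identities.

  \<^item> \<open>V_star\<close> equals \<open>B w0\<close> (\<open>V_star_eq_throughput_bound\<close>): sorting the ratios only sorts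
    out which argument of each minimum is the smaller one.

  \<^item> \<open>alpha_star\<close> equals \<open>B wu\<close> (\<open>alpha_star_eq_throughput_bound\<close>). Feasible weights are at
    most \<open>\<theta> * c\<close>, where \<open>\<theta>\<close> is total weight over supply. This forces \<open>r \<le> \<theta>\<close>, and so the
    supply, which is the total of \<open>w / \<theta>\<close>, is at most \<open>B wu\<close>.

  \<^item> The margin of robustness equals \<open>B w0\<close>
    (\<open>margin_of_robustness_u1\<close>).

  Thus the two equations in question hold if and only if \<open>B w0 = B wu\<close>. Since \<open>w0 \<le> wu\<close> this
  means equality of all summands, which is \<open>w_opt wl wu c \<le> w0\<close>.

  The margin is computed as follows. Along any trajectory the weights decrease, so they converge,
  and a link stops decreasing once it is underloaded or at its lower bound. If a limiting flow
  exceeds its capacity, that link is at its lower bound, so the limiting ratio \<open>\<theta>\<close> is below \<open>r\<close>,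
  while every link has kept at least \<open>min (w0 $ j) (\<theta> * c $ j)\<close>; summing up, the supply is at
  least \<open>B w0\<close>. Hence every supply below \<open>B w0\<close> is handled (\<open>u1_trajectory_feasible\<close>).
  Conversely, a feasible limit lies between \<open>wl\<close> and \<open>w0\<close>, so the static bound limits the supply
  by \<open>B w0\<close> (\<open>u1_feasible_limit_supply_le\<close>).

  The converse has content only if trajectories exist for supplies arbitrarily close to \<open>B w0\<close>.
  One is obtained as the least among all functions that fall no faster than the controller
  allows and stay above the weights at which the links come to rest; these resting weights depend
  monotonically on the function, so a pointwise infimum does the job. By minimality a link above
  its resting weight falls at full rate. A velocity for this Lipschitz function comes from the
  Radon-Nikodym theorem, and it lies in the Krasovskii set because links whose flow equals
  their capacity may move at independent speeds, except when all flows equal the capacities. That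
  exception is a single value of the supply, the total capacity, which can be avoided.
\<close>

section \<open>The static throughput bound\<close>

text \<open>
  The common closed form of \<open>V_star\<close> (with \<open>u\<close> the initial weights) and of
  \<open>alpha_star\<close> (with \<open>u\<close> the upper bounds); \<open>r\<close> stands for \<open>r_star wl c\<close>.
\<close>

definition throughput_bound :: "real \<Rightarrow> real^'n::finite \<Rightarrow> real^'n \<Rightarrow> real" where
  "throughput_bound r c u = (\<Sum>i\<in>UNIV. min (u $ i / r) (c $ i))"

lemma r_star_ge: "wl $ i / c $ i \<le> r_star wl c"
  unfolding r_star_def by (rule Max_ge) auto

lemma r_star_attained: "\<exists>i. wl $ i / c $ i = r_star wl c"
proof -
  have "r_star wl c \<in> range (\<lambda>i. wl $ i / c $ i)"
    unfolding r_star_def by (rule Max_in) auto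
  then show ?thesis by auto
qed

lemma r_star_pos:
  assumes "\<And>i. 0 < wl $ i" "\<And>i. 0 < c $ i"
  shows "0 < r_star wl c"
  using r_star_attained[of wl c] assms by (metis divide_pos_pos)

lemma throughput_bound_pos:
  assumes "0 < r" "\<And>i. 0 < c $ i" "\<And>i. 0 < u $ i"
  shows "0 < throughput_bound r c u"
  unfolding throughput_bound_def using assms by (intro sum_pos) auto

text \<open>
  Along the sorted labelling the links with \<open>w0 $ i / c $ i < r_star wl c\<close> are exactly
  those before position \<open>k_bar\<close>, and this inequality decides which argument of the minimum
  is the smaller one.
\<close>

lemma V_star_eq_throughput_bound:
  fixes wl c w0 :: "real^'n::finite"
  assumes wl: "\<And>i. 0 < wl $ i" and c: "\<And>i. 0 < c $ i"
    and w0: "wl \<le> w0" and p: "sorted_labelling w0 c p"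
  shows "V_star wl c w0 p = throughput_bound (r_star wl c) c w0"
proof -
  let ?n = "CARD('n)" and ?r = "r_star wl c"
  let ?K = "{j \<in> {1..?n}. ?r \<le> w0 $ p j / c $ p j}" and ?k = "k_bar wl c w0 p"
  let ?g = "\<lambda>i. min (w0 $ i / ?r) (c $ i)"
  have bij: "bij_betw p {1..?n} UNIV" and mono: "mono_on {1..?n} (\<lambda>j. w0 $ p j / c $ p j)"
    using p by (auto simp: sorted_labelling_def)
  have r: "0 < ?r" using r_star_pos wl c by blast
  obtain i where i: "wl $ i / c $ i = ?r" using r_star_attained by blast
  obtain j where j: "j \<in> {1..?n}" "p j = i" using bij by (metis UNIV_I bij_betw_imp_surj_on imageE)
  have "wl $ i / c $ i \<le> w0 $ i / c $ i"
    using w0 c by (simp add: less_eq_vec_def divide_right_mono less_imp_le)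
  \<comment> \<open>The minimum defining \<open>k_bar\<close> is over a nonempty set: a link attaining \<open>r_star\<close> belongs to it.\<close>
  then have ne: "j \<in> ?K" using i j by simp
  have k: "?k \<in> ?K" unfolding k_bar_def using ne by (intro Min_in) auto
  have above: "?g (p j) = c $ p j" if "j \<in> {?k..?n}" for j
  proof -
    have "w0 $ p ?k / c $ p ?k \<le> w0 $ p j / c $ p j"
      using that k by (intro mono_onD[OF mono]) auto
    then have "?r \<le> w0 $ p j / c $ p j" using k by auto
    then show ?thesis using r c by (simp add: field_simps)
  qed
  have below: "?g (p j) = w0 $ p j / ?r" if "j \<in> {1..?k - 1}" for j
  proof -
    have "j \<notin> ?K"
    proof
      assume "j \<in> ?K"
      then have "?k \<le> j" unfolding k_bar_def by (intro Min_le) auto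
      then show False using that by auto
    qed
    then have "w0 $ p j / c $ p j < ?r" using that k by auto
    then show ?thesis using r c[of "p j"] by (simp add: field_simps)
  qed
  have "throughput_bound ?r c w0 = (\<Sum>j\<in>{1..?n}. ?g (p j))"
    unfolding throughput_bound_def by (rule sum.reindex_bij_betw[OF bij, symmetric])
  also have "{1..?n} = {1..?k - 1} \<union> {?k..?n}" using k by auto
  also have "(\<Sum>j\<in>\<dots>. ?g (p j)) = (\<Sum>j\<in>{1..?k - 1}. ?g (p j)) + (\<Sum>j\<in>{?k..?n}. ?g (p j))"
    using k by (intro sum.union_disjoint) auto
  also have "\<dots> = (\<Sum>j\<in>{1..?k - 1}. w0 $ p j / ?r) + (\<Sum>j\<in>{?k..?n}. c $ p j)"
    using above below by (intro arg_cong2[where f="(+)"] sum.cong) auto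
  also have "\<dots> = V_star wl c w0 p"
    unfolding V_star_def by (simp add: sum_divide_distrib)
  finally show ?thesis by simp
qed

text \<open>
  Write \<open>\<theta>\<close> for total weight divided by supply. Feasibility says \<open>w $ i \<le> \<theta> * c $ i\<close>. On the
  link that attains \<open>r_star\<close> the lower bound on its weight turns this into
  \<open>r_star wl c \<le> \<theta>\<close>. The supply is the sum of the \<open>w $ i / \<theta>\<close>, and each of them is at most
  \<open>u $ i / r_star wl c\<close> and at most \<open>c $ i\<close>.
\<close>

lemma feasible_supply_le_throughput_bound:
  fixes wl c u w :: "real^'n::finite"
  assumes wl: "\<And>i. 0 < wl $ i" and c: "\<And>i. 0 < c $ i"
    and "wl \<le> w" "w \<le> u" and feas: "flow \<alpha> w \<le> c"
  shows "\<alpha> \<le> throughput_bound (r_star wl c) c u"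
proof (cases "0 < \<alpha>")
  case True
  let ?S = "\<Sum>j\<in>UNIV. w $ j" and ?r = "r_star wl c"
  define \<theta> where "\<theta> = ?S / \<alpha>"
  have w: "wl $ i \<le> w $ i" "w $ i \<le> u $ i" "0 < w $ i" for i
    using assms order.strict_trans2[OF wl, of i "w $ i"] by (auto simp: less_eq_vec_def)
  have S: "0 < ?S" using w by (intro sum_pos) auto
  have r: "0 < ?r" using r_star_pos wl c by blast
  have \<theta>: "0 < \<theta>" using S True by (simp add: \<theta>_def)
  have le: "w $ i \<le> \<theta> * c $ i" for i
  proof -
    have "\<alpha> * w $ i / ?S \<le> c $ i" using feas by (simp add: less_eq_vec_def flow_def)
    then show ?thesis using S True by (simp add: \<theta>_def field_simps)
  qed
  have "?r \<le> \<theta>"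
  proof -
    obtain i where "wl $ i / c $ i = ?r" using r_star_attained by blast
    moreover have "wl $ i / c $ i \<le> \<theta>"
      using le[of i] w(1)[of i] c[of i] by (simp add: pos_divide_le_eq)
    ultimately show ?thesis by simp
  qed
  have "\<alpha> = (\<Sum>j\<in>UNIV. w $ j / \<theta>)"
    using S True unfolding sum_divide_distrib[symmetric] by (simp add: \<theta>_def)
  also have "\<dots> \<le> throughput_bound ?r c u"
    unfolding throughput_bound_def
  proof (rule sum_mono, rule min.boundedI)
    fix j
    have "w $ j / \<theta> \<le> w $ j / ?r"
      using \<open>?r \<le> \<theta>\<close> r w(3)[of j] by (intro divide_left_mono) auto
    also have "\<dots> \<le> u $ j / ?r" using w r by (intro divide_right_mono) auto
    finally show "w $ j / \<theta> \<le> u $ j / ?r" .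
    show "w $ j / \<theta> \<le> c $ j" using le \<theta> by (simp add: field_simps)
  qed
  finally show ?thesis .
next
  case False
  have "0 < throughput_bound (r_star wl c) c u"
  proof (rule throughput_bound_pos)
    show "0 < u $ i" for i
      using assms(3,4) wl[of i] unfolding less_eq_vec_def by (meson less_le_trans)
  qed (use r_star_pos wl c in auto)
  then show ?thesis using False by linarith
qed

text \<open>
  The bound is attained at \<open>w $ i = min (wu $ i) (r_star wl c * c $ i)\<close>, whose total weight is
  \<open>r_star wl c\<close> times the supply.
\<close>

lemma alpha_star_eq_throughput_bound:
  fixes wl wu c :: "real^'n::finite"
  assumes wl: "\<And>i. 0 < wl $ i" and c: "\<And>i. 0 < c $ i" and "wl \<le> wu"
  shows "alpha_star wl wu c = ereal (throughput_bound (r_star wl c) c wu)"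
proof (rule antisym)
  show "alpha_star wl wu c \<le> ereal (throughput_bound (r_star wl c) c wu)"
    unfolding alpha_star_def
    using feasible_supply_le_throughput_bound[OF wl c] by (auto intro!: Sup_least)
next
  let ?r = "r_star wl c" and ?\<alpha> = "throughput_bound (r_star wl c) c wu"
  have r: "0 < ?r" using r_star_pos wl c by blast
  define w :: "real^'n" where "w = (\<chi> i. min (wu $ i) (?r * c $ i))"
  have "wl $ i \<le> ?r * c $ i" for i
    using r_star_ge[of wl i c] c[of i] by (simp add: field_simps)
  then have wlw: "wl \<le> w" using assms(3) by (simp add: w_def less_eq_vec_def)
  have wwu: "w \<le> wu" by (simp add: w_def less_eq_vec_def)
  have w: "0 < w $ i" for i using wl[of i] wlw unfolding less_eq_vec_def by (meson less_le_trans)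
  have wr: "w $ i / ?r = min (wu $ i / ?r) (c $ i)" for i
    using r by (simp add: w_def min_def field_simps)
  have \<alpha>: "?\<alpha> = (\<Sum>i\<in>UNIV. w $ i) / ?r"
    by (simp add: throughput_bound_def sum_divide_distrib wr)
  have S: "0 < (\<Sum>i\<in>UNIV. w $ i)" using w by (intro sum_pos) auto
  have "flow ?\<alpha> w $ i = w $ i / ?r" for i
    using S by (simp add: flow_def \<alpha>)
  moreover have "0 \<le> w $ i / ?r" "w $ i / ?r \<le> c $ i" for i
    using w[of i] r by (simp, simp add: wr)
  ultimately have "0 \<le> flow ?\<alpha> w" "flow ?\<alpha> w \<le> c"
    by (simp_all add: less_eq_vec_def)
  then show "ereal ?\<alpha> \<le> alpha_star wl wu c"
    unfolding alpha_star_def using wlw wwu by (intro Sup_upper) blast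
qed

text \<open>
  The bound is monotone summand by summand, so two comparable weight vectors have equal bounds
  only if all summands agree.
\<close>

lemma throughput_bound_eq_iff:
  fixes w0 wu c :: "real^'n::finite"
  assumes r: "0 < r" and "w0 \<le> wu"
  shows "throughput_bound r c w0 = throughput_bound r c wu
         \<longleftrightarrow> (\<forall>i. min (c $ i * r) (wu $ i) \<le> w0 $ i)"
proof -
  have le: "min (w0 $ i / r) (c $ i) \<le> min (wu $ i / r) (c $ i)" for i
    using assms by (intro min.mono divide_right_mono) (auto simp: less_eq_vec_def)
  have "throughput_bound r c w0 = throughput_bound r c wu
      \<longleftrightarrow> (\<forall>i. min (wu $ i / r) (c $ i) - min (w0 $ i / r) (c $ i) = 0)"
    unfolding throughput_bound_def
    using le sum_nonneg_eq_0_iff[of UNIV "\<lambda>i. min (wu $ i / r) (c $ i) - min (w0 $ i / r) (c $ i)"]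
    by (auto simp: sum_subtractf)
  also have "\<dots> \<longleftrightarrow> (\<forall>i. min (c $ i * r) (wu $ i) \<le> w0 $ i)"
  proof (intro all_cong1)
    fix i
    have "w0 $ i \<le> wu $ i" using assms by (simp add: less_eq_vec_def)
    then show "(min (wu $ i / r) (c $ i) - min (w0 $ i / r) (c $ i) = 0)
        \<longleftrightarrow> min (c $ i * r) (wu $ i) \<le> w0 $ i"
      using r by (auto simp: min_def field_simps)
  qed
  finally show ?thesis .
qed

section \<open>Indefinite integrals on the half-line\<close>

text \<open>
  Each component of a Krasovskii solution has this form. Reducing to scalar functions avoids
  vector-valued integrals in all monotonicity arguments.
\<close>

definition halfline_primitive :: "(real \<Rightarrow> real) \<Rightarrow> (real \<Rightarrow> real) \<Rightarrow> bool" where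
  "halfline_primitive v x \<longleftrightarrow> (\<forall>t\<ge>0. v integrable_on {0..t} \<and> x t = x 0 + integral {0..t} v)"

lemma halfline_primitive_increment:
  assumes "halfline_primitive v x" "0 \<le> s" "s \<le> t"
  shows "(v has_integral (x t - x s)) {s..t}"
proof -
  have v: "v integrable_on {0..t}" "x t = x 0 + integral {0..t} v" "x s = x 0 + integral {0..s} v"
    using assms order_trans[OF assms(2,3)] unfolding halfline_primitive_def by blast+
  have "integral {0..s} v + integral {s..t} v = integral {0..t} v"
    using assms v by (intro Henstock_Kurzweil_Integration.integral_combine) auto
  then have "integral {s..t} v = x t - x s" using v by simp
  moreover have "v integrable_on {s..t}"
    using v(1) assms by (auto intro: integrable_subinterval_real)
  ultimately show ?thesis by (metis integrable_integral)
qed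

lemma halfline_primitive_continuous:
  assumes "halfline_primitive v x"
  shows "continuous_on {0..t} x"
proof (cases "0 \<le> t")
  case True
  then have "continuous_on {0..t} (\<lambda>s. x 0 + integral {0..s} v)"
    using assms unfolding halfline_primitive_def
    by (intro continuous_intros indefinite_integral_continuous_1) auto
  moreover have "x s = x 0 + integral {0..s} v" if "s \<in> {0..t}" for s
    using assms that unfolding halfline_primitive_def by (metis atLeastAtMost_iff)
  ultimately show ?thesis by (metis (no_types, lifting) continuous_on_cong)
qed simp

lemma halfline_primitive_le:
  assumes x: "halfline_primitive v x" and st: "0 \<le> s" "s \<le> t"
    and le: "AE u in lebesgue. s < u \<longrightarrow> u < t \<longrightarrow> v u \<le> k"
  shows "x t - x s \<le> k * (t - s)"
proof -
  obtain N where N: "negligible N" "{u. \<not> (s < u \<longrightarrow> u < t \<longrightarrow> v u \<le> k)} \<subseteq> N"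
    using le unfolding negligible_iff_null_sets eventually_ae_filter by auto
  \<comment> \<open>The integrand is changed on a null set, so that the bound holds everywhere on the interval.\<close>
  let ?v = "\<lambda>u. if u \<in> N \<union> {s, t} then k else v u"
  have "(?v has_integral (x t - x s)) {s..t}"
    using N by (intro has_integral_spike[OF _ _ halfline_primitive_increment[OF x st], where S="N \<union> {s, t}"])
      (auto intro: negligible_Un)
  moreover have "((\<lambda>u. k) has_integral (k * (t - s))) {s..t}"
    using st has_integral_const_real[of k s t] by (simp add: mult.commute)
  moreover have "?v u \<le> k" if "u \<in> {s..t}" for u
    using N that by (auto simp: subset_iff less_le)
  ultimately show ?thesis by (rule has_integral_le)
qed

lemma halfline_primitive_ge:
  assumes x: "halfline_primitive v x" and st: "0 \<le> s" "s \<le> t"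
    and ge: "AE u in lebesgue. s < u \<longrightarrow> u < t \<longrightarrow> k \<le> v u"
  shows "k * (t - s) \<le> x t - x s"
proof -
  have "halfline_primitive (\<lambda>u. - v u) (\<lambda>u. - x u)"
    unfolding halfline_primitive_def
  proof (intro allI impI conjI)
    fix t :: real assume "0 \<le> t"
    then have v: "v integrable_on {0..t}" and xt: "x t = x 0 + integral {0..t} v"
      using x unfolding halfline_primitive_def by blast+
    show "(\<lambda>u. - v u) integrable_on {0..t}" using v by (rule integrable_neg)
    show "- x t = - x 0 + integral {0..t} (\<lambda>u. - v u)" by (subst xt) simp
  qed
  from halfline_primitive_le[OF this st, of "- k"] ge show ?thesis
    by simp
qed

text \<open>
  After the last time at which \<open>x\<close> is at least \<open>min (x 0) b\<close> the function stays below \<open>b\<close>, so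
  it does not decrease any more. This is how links that are idle below some weight are shown to
  stay above it.
\<close>

lemma halfline_primitive_barrier:
  assumes x: "halfline_primitive v x"
    and ge: "AE u in lebesgue. 0 < u \<longrightarrow> x u < b \<longrightarrow> 0 \<le> v u" and t: "0 \<le> t"
  shows "min (x 0) b \<le> x t"
proof (rule ccontr)
  assume low: "\<not> min (x 0) b \<le> x t"
  let ?m = "min (x 0) b"
  let ?A = "{s \<in> {0..t}. ?m \<le> x s}"
  have "closed ?A"
    using halfline_primitive_continuous[OF x, of t] by (intro continuous_on_closed_Collect_le) auto
  moreover have "bounded ?A" by (rule bounded_subset[of "{0..t}"]) auto
  ultimately have "compact ?A" by (simp add: compact_eq_bounded_closed)
  moreover have "0 \<in> ?A" using t by auto
  ultimately obtain s where s: "s \<in> ?A" "\<And>u. u \<in> ?A \<Longrightarrow> u \<le> s"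
    using compact_attains_sup[of ?A] by blast
  have "x u < b" if "s < u" "u < t" for u
  proof -
    have "u \<notin> ?A" using s(2)[of u] that by linarith
    then show ?thesis using that s(1) by auto
  qed
  then have "AE u in lebesgue. s < u \<longrightarrow> u < t \<longrightarrow> 0 \<le> v u"
    using ge s(1) by (auto elim!: eventually_mono)
  then have "0 * (t - s) \<le> x t - x s"
    using s(1) by (intro halfline_primitive_ge[OF x]) auto
  then show False using s(1) low by auto
qed

lemma antitone_on_halfline_converges:
  fixes x :: "real \<Rightarrow> real"
  assumes mono: "\<And>s t. 0 \<le> s \<Longrightarrow> s \<le> t \<Longrightarrow> x t \<le> x s"
    and bound: "\<And>t. 0 \<le> t \<Longrightarrow> b \<le> x t"
  obtains l where "(x \<longlongrightarrow> l) at_top" "b \<le> l" "\<And>t. 0 \<le> t \<Longrightarrow> l \<le> x t"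
proof
  let ?l = "Inf (x ` {0..})"
  have bdd: "bdd_below (x ` {0..})" using bound by (auto intro!: bdd_belowI)
  show lower: "?l \<le> x t" if "0 \<le> t" for t
    using that bdd by (intro cInf_lower) auto
  show "b \<le> ?l" using bound by (intro cInf_greatest) auto
  show "(x \<longlongrightarrow> ?l) at_top"
  proof (rule decreasing_tendsto)
    show "\<forall>\<^sub>F t in at_top. ?l \<le> x t"
      using eventually_ge_at_top[of 0] by (rule eventually_mono) (rule lower)
    fix y assume "?l < y"
    then obtain s where "0 \<le> s" and "x s < y"
      using cInf_lessD[of "x ` {0..}" y] by auto
    then have "x t < y" if "s \<le> t" for t
      using mono[of s t] that by simp
    then show "\<forall>\<^sub>F t in at_top. x t < y"
      by (rule eventually_mono[OF eventually_ge_at_top])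
  qed
qed

section \<open>Velocities of the controlled network\<close>

lemma krasovskii_subset:
  assumes "closed C" "convex C" "0 < \<delta>" "X ` ball x \<delta> \<subseteq> C"
  shows "krasovskii X x \<subseteq> C"
proof -
  have "closure (convex hull (X ` ball x \<delta>)) \<subseteq> C"
    using assms by (intro closure_minimal hull_minimal)
  then show ?thesis using assms(3) unfolding krasovskii_def by blast
qed

text \<open>
  The regularisation sees the vector field only near the point: a closed convex constraint on
  one component of the field that holds in a neighbourhood passes to all velocities.
\<close>

lemma krasovskii_component:
  fixes X :: "real^'n::finite \<Rightarrow> real^'n"
  assumes "closed K" "convex K" and ev: "\<forall>\<^sub>F y in nhds x. X y $ i \<in> K"
    and v: "v \<in> krasovskii X x"
  shows "v $ i \<in> K"
proof -
  obtain \<delta> where \<delta>: "0 < \<delta>" "\<And>y. dist y x < \<delta> \<Longrightarrow> X y $ i \<in> K"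
    using ev unfolding eventually_nhds_metric by blast
  have "closed ((\<lambda>v::real^'n. v $ i) -` K)"
    using assms(1) by (intro closed_vimage continuous_intros)
  moreover have "convex ((\<lambda>v::real^'n. v $ i) -` K)"
    using assms(2) by (intro convex_linear_vimage) (auto intro!: linearI)
  ultimately have "krasovskii X x \<subseteq> (\<lambda>v::real^'n. v $ i) -` K"
    using \<delta> by (intro krasovskii_subset[where \<delta>=\<delta>]) (auto simp: dist_commute)
  then show ?thesis using v by auto
qed

lemma isCont_flow:
  fixes x :: "real^'n::finite"
  assumes "(\<Sum>j\<in>UNIV. x $ j) \<noteq> 0"
  shows "isCont (flow \<alpha>) x"
  unfolding isCont_def flow_def using assms
  by (intro vec_tendstoI) (auto intro!: tendsto_intros)

context
  fixes rate c wl x v :: "real^'n::finite" and \<beta> :: real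
  assumes rate: "\<And>i. 0 < rate $ i" and x: "\<And>i. 0 < x $ i"
    and v: "v \<in> krasovskii (closed_loop (u1 rate c wl) \<beta>) x"
begin

lemma flow_tendsto: "((\<lambda>y. flow \<beta> y $ i) \<longlongrightarrow> flow \<beta> x $ i) (nhds x)"
proof -
  have "0 < (\<Sum>j\<in>UNIV. x $ j)" using x by (intro sum_pos) auto
  then have "isCont (flow \<beta>) x" by (intro isCont_flow) auto
  then have "((\<lambda>y. flow \<beta> y) \<longlongrightarrow> flow \<beta> x) (nhds x)"
    by (simp add: isCont_def tendsto_at_iff_tendsto_nhds)
  then show ?thesis by (rule tendsto_vec_nth)
qed

lemma component_tendsto: "((\<lambda>y. y $ i) \<longlongrightarrow> x $ i) (nhds x)"
  by (intro tendsto_vec_nth filterlim_ident)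

lemma krasovskii_u1_bounds: "- (rate $ i) \<le> v $ i" "v $ i \<le> 0"
  using krasovskii_component[OF _ _ _ v, of "{- (rate $ i)..0}" i] rate[of i]
  by (auto simp: closed_loop_def u1_def)

text \<open>
  Both conditions are open, and each of them switches the controller of link \<open>i\<close> off.
\<close>

lemma krasovskii_u1_idle:
  assumes "x $ i < wl $ i \<or> flow \<beta> x $ i < c $ i"
  shows "v $ i = 0"
proof -
  have "\<forall>\<^sub>F y in nhds x. closed_loop (u1 rate c wl) \<beta> y $ i \<in> {0}"
    using assms
  proof
    assume "x $ i < wl $ i"
    from order_tendstoD(2)[OF component_tendsto this] show ?thesis
      by eventually_elim (simp add: closed_loop_def u1_def)
  next
    assume "flow \<beta> x $ i < c $ i"
    from order_tendstoD(2)[OF flow_tendsto this] show ?thesis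
      by eventually_elim (simp add: closed_loop_def u1_def)
  qed
  from krasovskii_component[OF _ _ this v] show ?thesis by simp
qed

lemma krasovskii_u1_active:
  assumes "wl $ i < x $ i" "c $ i < flow \<beta> x $ i"
  shows "v $ i = - (rate $ i)"
proof -
  have "\<forall>\<^sub>F y in nhds x. closed_loop (u1 rate c wl) \<beta> y $ i \<in> {- (rate $ i)}"
    using order_tendstoD(1)[OF component_tendsto assms(1)] order_tendstoD(1)[OF flow_tendsto assms(2)]
    by eventually_elim (simp add: closed_loop_def u1_def)
  from krasovskii_component[OF _ _ this v] show ?thesis by simp
qed

end

lemma trajectory_velocity:
  assumes "trajectory u \<beta> w0 w"
  obtains v where "\<And>i. halfline_primitive (\<lambda>t. v t $ i) (\<lambda>t. w t $ i)"
    "AE t in lebesgue. 0 \<le> t \<longrightarrow> v t \<in> krasovskii (closed_loop u \<beta>) (w t)"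
proof -
  obtain v where v: "\<forall>t\<ge>0. v absolutely_integrable_on {0..t} \<and> w t = w 0 + integral {0..t} v"
    "AE t in lebesgue. 0 \<le> t \<longrightarrow> v t \<in> krasovskii (closed_loop u \<beta>) (w t)"
    using assms unfolding trajectory_def krasovskii_solution_def by blast
  have "halfline_primitive (\<lambda>t. v t $ i) (\<lambda>t. w t $ i)" for i
    unfolding halfline_primitive_def
  proof (intro allI impI conjI)
    fix t :: real assume "0 \<le> t"
    then have "v absolutely_integrable_on {0..t}" and wt: "w t = w 0 + integral {0..t} v"
      using v(1) by blast+
    then have vi: "v integrable_on {0..t}"
      by (simp add: set_lebesgue_integral_eq_integral(1))
    show "(\<lambda>t. v t $ i) integrable_on {0..t}"
      using integrable_component[OF vi, of "axis i 1"] by (simp add: inner_axis)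
    show "w t $ i = w 0 $ i + integral {0..t} (\<lambda>t. v t $ i)"
      by (subst wt) (simp add: vi)
  qed
  then show ?thesis using v(2) that by blast
qed

section \<open>Limits of trajectories\<close>

lemma u1_trajectory_velocity:
  fixes rate c wl w0 :: "real^'n::finite"
  assumes rate: "\<And>i. 0 < rate $ i" and w: "trajectory (u1 rate c wl) \<beta> w0 w"
  obtains v where "\<And>i. halfline_primitive (\<lambda>t. v t $ i) (\<lambda>t. w t $ i)"
    "AE t in lebesgue. 0 \<le> t \<longrightarrow> (\<forall>i. - (rate $ i) \<le> v t $ i \<and> v t $ i \<le> 0 \<and>
       (w t $ i < wl $ i \<or> flow \<beta> (w t) $ i < c $ i \<longrightarrow> v t $ i = 0) \<and>
       (wl $ i < w t $ i \<and> c $ i < flow \<beta> (w t) $ i \<longrightarrow> v t $ i = - (rate $ i)))"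
proof -
  have pos: "0 < w t $ i" if "0 \<le> t" for t i
    using w that by (simp add: trajectory_def)
  obtain v where prim: "\<And>i. halfline_primitive (\<lambda>t. v t $ i) (\<lambda>t. w t $ i)"
    and kr: "AE t in lebesgue. 0 \<le> t \<longrightarrow> v t \<in> krasovskii (closed_loop (u1 rate c wl) \<beta>) (w t)"
    using trajectory_velocity[OF w] by blast
  show ?thesis
  proof (rule that[OF prim], use kr in \<open>eventually_elim\<close>, intro impI allI)
    fix t i
    assume "0 \<le> t \<longrightarrow> v t \<in> krasovskii (closed_loop (u1 rate c wl) \<beta>) (w t)" and t: "0 \<le> t"
    then have "v t \<in> krasovskii (closed_loop (u1 rate c wl) \<beta>) (w t)" by simp
    note facts = rate pos[OF t] this
    show "- (rate $ i) \<le> v t $ i \<and> v t $ i \<le> 0 \<and>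
       (w t $ i < wl $ i \<or> flow \<beta> (w t) $ i < c $ i \<longrightarrow> v t $ i = 0) \<and>
       (wl $ i < w t $ i \<and> c $ i < flow \<beta> (w t) $ i \<longrightarrow> v t $ i = - (rate $ i))"
      using krasovskii_u1_bounds[OF facts] krasovskii_u1_idle[OF facts]
        krasovskii_u1_active[OF facts] by blast
  qed
qed

lemma flow_limit:
  fixes w :: "real \<Rightarrow> real^'n::finite"
  assumes lim: "\<And>i. ((\<lambda>t. w t $ i) \<longlongrightarrow> W $ i) at_top" and W: "\<And>i. 0 < W $ i"
  shows "((\<lambda>t. flow \<alpha> (w t)) \<longlongrightarrow> flow \<alpha> W) at_top"
proof -
  have "0 < (\<Sum>j\<in>UNIV. W $ j)" using W by (intro sum_pos) auto
  then have "isCont (flow \<alpha>) W" by (intro isCont_flow) auto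
  moreover have "(w \<longlongrightarrow> W) at_top" using lim by (intro vec_tendstoI)
  ultimately show ?thesis by (rule isCont_tendsto_compose)
qed

context
  fixes rate c wl w0 :: "real^'n::finite" and \<beta> :: real and w :: "real \<Rightarrow> real^'n"
  assumes wl: "\<And>i. 0 < wl $ i" and c: "\<And>i. 0 < c $ i" and rate: "\<And>i. 0 < rate $ i"
    and w0: "wl \<le> w0" and w: "trajectory (u1 rate c wl) \<beta> w0 w"
begin

lemma u1_trajectory_limit:
  obtains W where "\<And>i. ((\<lambda>t. w t $ i) \<longlongrightarrow> W $ i) at_top"
    "\<And>i. wl $ i \<le> W $ i" "\<And>t i. 0 \<le> t \<Longrightarrow> W $ i \<le> w t $ i"
proof -
  obtain v where prim: "\<And>i. halfline_primitive (\<lambda>t. v t $ i) (\<lambda>t. w t $ i)"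
    and vel: "AE t in lebesgue. 0 \<le> t \<longrightarrow> (\<forall>i. - (rate $ i) \<le> v t $ i \<and> v t $ i \<le> 0 \<and>
       (w t $ i < wl $ i \<or> flow \<beta> (w t) $ i < c $ i \<longrightarrow> v t $ i = 0) \<and>
       (wl $ i < w t $ i \<and> c $ i < flow \<beta> (w t) $ i \<longrightarrow> v t $ i = - (rate $ i)))"
    using u1_trajectory_velocity[OF rate w] by blast
  have start: "w 0 = w0" using w by (simp add: trajectory_def)
  have antitone: "w t $ i \<le> w s $ i" if "0 \<le> s" "s \<le> t" for s t i
  proof -
    have "AE u in lebesgue. s < u \<longrightarrow> u < t \<longrightarrow> v u $ i \<le> 0"
      using vel by eventually_elim (use that in auto)
    from halfline_primitive_le[OF prim that this] show ?thesis by simp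
  qed
  have above: "wl $ i \<le> w t $ i" if "0 \<le> t" for t i
  proof -
    have "AE u in lebesgue. 0 < u \<longrightarrow> w u $ i < wl $ i \<longrightarrow> 0 \<le> v u $ i"
      using vel by eventually_elim auto
    from halfline_primitive_barrier[OF prim this that] show ?thesis
      using w0 by (simp add: start less_eq_vec_def min_absorb2)
  qed
  have "\<exists>l. ((\<lambda>t. w t $ i) \<longlongrightarrow> l) at_top \<and> wl $ i \<le> l \<and> (\<forall>t\<ge>0. l \<le> w t $ i)" for i
    by (rule antitone_on_halfline_converges[of "\<lambda>t. w t $ i" "wl $ i"]) (use antitone above in auto)
  then obtain W where "\<And>i. ((\<lambda>t. w t $ i) \<longlongrightarrow> W i) at_top \<and> wl $ i \<le> W i \<and> (\<forall>t\<ge>0. W i \<le> w t $ i)"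
    by metis
  then show ?thesis by (intro that[of "\<chi> i. W i"]) auto
qed

text \<open>
  A link that is overloaded in the limit is overloaded from some time on. If its weight stayed
  above the lower bound, it would be decreased at the constant rate forever and would become
  negative.
\<close>

lemma u1_overloaded_limit:
  assumes lim: "\<And>i. ((\<lambda>t. w t $ i) \<longlongrightarrow> W $ i) at_top"
    and Wl: "\<And>i. wl $ i \<le> W $ i" and Ww: "\<And>t i. 0 \<le> t \<Longrightarrow> W $ i \<le> w t $ i"
    and over: "c $ i < flow \<beta> W $ i"
  shows "W $ i = wl $ i"
proof (rule ccontr)
  assume "W $ i \<noteq> wl $ i"
  then have strict: "wl $ i < W $ i" using Wl[of i] by simp
  obtain v where prim: "\<And>i. halfline_primitive (\<lambda>t. v t $ i) (\<lambda>t. w t $ i)"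
    and vel: "AE t in lebesgue. 0 \<le> t \<longrightarrow> (\<forall>i. - (rate $ i) \<le> v t $ i \<and> v t $ i \<le> 0 \<and>
       (w t $ i < wl $ i \<or> flow \<beta> (w t) $ i < c $ i \<longrightarrow> v t $ i = 0) \<and>
       (wl $ i < w t $ i \<and> c $ i < flow \<beta> (w t) $ i \<longrightarrow> v t $ i = - (rate $ i)))"
    using u1_trajectory_velocity[OF rate w] by blast
  have "((\<lambda>t. flow \<beta> (w t)) \<longlongrightarrow> flow \<beta> W) at_top"
    using lim by (intro flow_limit) (use Wl wl in \<open>auto intro: less_le_trans\<close>)
  then have "((\<lambda>t. flow \<beta> (w t) $ i) \<longlongrightarrow> flow \<beta> W $ i) at_top" by (rule tendsto_vec_nth)
  then have "\<forall>\<^sub>F t in at_top. c $ i < flow \<beta> (w t) $ i" using over by (rule order_tendstoD)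
  then obtain T where T: "0 \<le> T" "\<And>t. T \<le> t \<Longrightarrow> c $ i < flow \<beta> (w t) $ i"
    using that[of "max 0 N" for N] unfolding eventually_at_top_linorder by auto
  \<comment> \<open>At this time the constant rate would have used up the whole weight present at time \<open>T\<close>.\<close>
  define t where "t = T + w T $ i / rate $ i"
  have "0 < w T $ i" using w T(1) by (simp add: trajectory_def)
  then have "T \<le> t" using rate[of i] by (simp add: t_def)
  have "AE u in lebesgue. T < u \<longrightarrow> u < t \<longrightarrow> v u $ i \<le> - (rate $ i)"
    using vel
  proof eventually_elim
    case (elim u)
    show ?case
    proof (intro impI)
      assume "T < u" "u < t"
      then have "wl $ i < w u $ i" "c $ i < flow \<beta> (w u) $ i" "0 \<le> u"
        using strict Ww[of u i] T(1) T(2)[of u] by auto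
      then show "v u $ i \<le> - (rate $ i)" using elim by auto
    qed
  qed
  from halfline_primitive_le[OF prim T(1) \<open>T \<le> t\<close> this]
  have "w t $ i \<le> 0" using rate[of i] by (simp add: t_def)
  moreover have "0 < w t $ i" using w T(1) \<open>T \<le> t\<close> by (simp add: trajectory_def)
  ultimately show False by simp
qed

text \<open>
  A link is decreased only while its flow is at least its capacity, that is, while its weight is
  at least \<open>c $ i / \<beta>\<close> times the current total weight. The total weight is never below its
  limit, so below the level given by the limit the link rests.
\<close>

lemma u1_underloaded_links_keep_weight:
  assumes lim: "\<And>i. ((\<lambda>t. w t $ i) \<longlongrightarrow> W $ i) at_top"
    and Wl: "\<And>i. wl $ i \<le> W $ i" and Ww: "\<And>t i. 0 \<le> t \<Longrightarrow> W $ i \<le> w t $ i"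
    and \<beta>: "0 < \<beta>"
  shows "min (w0 $ i) (c $ i * (\<Sum>j\<in>UNIV. W $ j) / \<beta>) \<le> W $ i"
proof -
  let ?b = "c $ i * (\<Sum>j\<in>UNIV. W $ j) / \<beta>"
  obtain v where prim: "\<And>i. halfline_primitive (\<lambda>t. v t $ i) (\<lambda>t. w t $ i)"
    and vel: "AE t in lebesgue. 0 \<le> t \<longrightarrow> (\<forall>i. - (rate $ i) \<le> v t $ i \<and> v t $ i \<le> 0 \<and>
       (w t $ i < wl $ i \<or> flow \<beta> (w t) $ i < c $ i \<longrightarrow> v t $ i = 0) \<and>
       (wl $ i < w t $ i \<and> c $ i < flow \<beta> (w t) $ i \<longrightarrow> v t $ i = - (rate $ i)))"
    using u1_trajectory_velocity[OF rate w] by blast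
  have under: "flow \<beta> (w u) $ i < c $ i" if "0 \<le> u" "w u $ i < ?b" for u
  proof -
    have S: "0 < (\<Sum>j\<in>UNIV. w u $ j)"
      using w that by (intro sum_pos) (auto simp: trajectory_def)
    have "\<beta> * w u $ i < c $ i * (\<Sum>j\<in>UNIV. W $ j)" using that(2) \<beta> by (simp add: field_simps)
    also have "\<dots> \<le> c $ i * (\<Sum>j\<in>UNIV. w u $ j)"
      using Ww that(1) c[of i] by (intro mult_left_mono sum_mono) auto
    finally show ?thesis using S by (simp add: flow_def field_simps)
  qed
  have "AE u in lebesgue. 0 < u \<longrightarrow> w u $ i < ?b \<longrightarrow> 0 \<le> v u $ i"
    using vel by eventually_elim (use under in auto)
  from halfline_primitive_barrier[OF prim this]
  have "min (w0 $ i) ?b \<le> w t $ i" if "0 \<le> t" for t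
    using that w by (simp add: trajectory_def)
  then have "\<forall>\<^sub>F t in at_top. min (w0 $ i) ?b \<le> w t $ i"
    by (rule eventually_mono[OF eventually_ge_at_top])
  then show ?thesis using lim[of i] by (intro tendsto_lowerbound) auto
qed

text \<open>
  Suppose link \<open>i\<close> is overloaded in the limit, and let \<open>\<theta>\<close> be the limiting total weight
  divided by \<open>\<beta>\<close>. The link is at its lower bound, so \<open>\<theta> < wl $ i / c $ i \<le> r_star wl c\<close>. All
  limiting weights are at least \<open>min (w0 $ j) (\<theta> * c $ j)\<close>. Dividing by \<open>\<theta>\<close> and summing
  gives \<open>throughput_bound (r_star wl c) c w0 \<le> \<beta>\<close>.
\<close>

lemma u1_trajectory_feasible:
  assumes \<beta>: "0 \<le> \<beta>" "\<beta> < throughput_bound (r_star wl c) c w0"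
  shows "feasible_limit c \<beta> w"
proof -
  obtain W where lim: "\<And>i. ((\<lambda>t. w t $ i) \<longlongrightarrow> W $ i) at_top"
    and Wl: "\<And>i. wl $ i \<le> W $ i" and Ww: "\<And>t i. 0 \<le> t \<Longrightarrow> W $ i \<le> w t $ i"
    by (rule u1_trajectory_limit) (rule that; blast)
  let ?S = "\<Sum>j\<in>UNIV. W $ j" and ?r = "r_star wl c"
  have W: "0 < W $ i" for i using Wl wl by (rule less_le_trans[rotated])
  have S: "0 < ?S" using W by (intro sum_pos) auto
  have r: "0 < ?r" using r_star_pos wl c by blast
  have "flow \<beta> W $ i \<le> c $ i" for i
  proof (rule ccontr)
    assume "\<not> flow \<beta> W $ i \<le> c $ i"
    then have over: "c $ i < flow \<beta> W $ i" by simp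
    then have pos: "0 < \<beta>" using \<beta>(1) c[of i] by (cases "\<beta> = 0") (auto simp: flow_def)
    define \<theta> where "\<theta> = ?S / \<beta>"
    have \<theta>: "0 < \<theta>" using S pos by (simp add: \<theta>_def)
    have "c $ i * \<theta> < wl $ i"
      using over u1_overloaded_limit[OF lim Wl Ww over] S pos
      by (simp add: flow_def \<theta>_def field_simps)
    then have "\<theta> < wl $ i / c $ i" using c[of i] by (simp add: field_simps)
    then have "\<theta> < ?r" using r_star_ge[of wl i c] by simp
    have "throughput_bound ?r c w0 \<le> (\<Sum>j\<in>UNIV. W $ j / \<theta>)"
      unfolding throughput_bound_def
    proof (rule sum_mono)
      fix j
      have "0 < w0 $ j" using w0 wl[of j] by (auto simp: less_eq_vec_def intro: less_le_trans)
      then have "w0 $ j / ?r \<le> w0 $ j / \<theta>"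
        using \<theta> \<open>\<theta> < ?r\<close> by (intro divide_left_mono) auto
      then have "min (w0 $ j / ?r) (c $ j) \<le> min (w0 $ j / \<theta>) (c $ j)" by auto
      also have "\<dots> = min (w0 $ j) (c $ j * \<theta>) / \<theta>" using \<theta> by (auto simp: min_def field_simps)
      also have "\<dots> \<le> W $ j / \<theta>"
        using u1_underloaded_links_keep_weight[OF lim Wl Ww pos, of j] \<theta>
        by (intro divide_right_mono) (auto simp: \<theta>_def)
      finally show "min (w0 $ j / ?r) (c $ j) \<le> W $ j / \<theta>" .
    qed
    also have "\<dots> = ?S / \<theta>" by (simp add: sum_divide_distrib)
    also have "\<dots> = \<beta>" using S pos by (simp add: \<theta>_def)
    finally show False using \<beta>(2) by simp
  qed
  moreover have "0 \<le> flow \<beta> W $ i" for i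
    using S W[of i] \<beta>(1) by (simp add: flow_def)
  ultimately show ?thesis
    using flow_limit[of w W, OF lim W] unfolding feasible_limit_def less_eq_vec_def zero_index by blast
qed

text \<open>
  The limiting weights lie between \<open>wl\<close> and \<open>w0\<close>; if their flow is feasible, the static bound
  applies to them.
\<close>

lemma u1_feasible_limit_supply_le:
  assumes "feasible_limit c \<beta> w"
  shows "\<beta> \<le> throughput_bound (r_star wl c) c w0"
proof -
  obtain W where lim: "\<And>i. ((\<lambda>t. w t $ i) \<longlongrightarrow> W $ i) at_top"
    and Wl: "\<And>i. wl $ i \<le> W $ i" and Ww: "\<And>t i. 0 \<le> t \<Longrightarrow> W $ i \<le> w t $ i"
    by (rule u1_trajectory_limit) (rule that; blast)
  have W: "0 < W $ i" for i using Wl wl by (rule less_le_trans[rotated])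
  have "flow \<beta> W \<le> c"
    using assms tendsto_unique[OF _ flow_limit[of w W, OF lim W]] unfolding feasible_limit_def by force
  moreover have "W \<le> w0" using Ww[of 0] w by (simp add: less_eq_vec_def trajectory_def)
  ultimately show ?thesis
    using Wl by (intro feasible_supply_le_throughput_bound[OF wl c]) (auto simp: less_eq_vec_def)
qed

end

section \<open>Densities of monotone Lipschitz functions\<close>

lemma emeasure_interval_measure_singleton:
  fixes F :: "real \<Rightarrow> real"
  assumes "mono F" "continuous_on UNIV F"
  shows "emeasure (interval_measure F) {x} = 0"
  using emeasure_interval_measure_Icc[of x x F] assms
  by (auto simp: mono_def intro: continuous_on_subset)

lemma emeasure_interval_measure_Ioo:
  fixes F :: "real \<Rightarrow> real"
  assumes F: "mono F" "continuous_on UNIV F" and "a \<le> b"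
  shows "emeasure (interval_measure F) {a<..<b} = ennreal (F b - F a)"
proof -
  have cont: "continuous (at_right a) F" for a
    using F(2) by (simp add: continuous_on_eq_continuous_within continuous_at_imp_continuous_within)
  show ?thesis
  proof (cases "a = b")
    case False
    have "emeasure (interval_measure F) {a<..b} = emeasure (interval_measure F) ({a<..<b} \<union> {b})"
      using assms False by (intro arg_cong[where f="emeasure _"]) auto
    also have "\<dots> = emeasure (interval_measure F) {a<..<b} + emeasure (interval_measure F) {b}"
      by (intro plus_emeasure[symmetric]) auto
    also have "emeasure (interval_measure F) {b} = 0"
      using emeasure_interval_measure_singleton F by blast
    finally show ?thesis
      using emeasure_interval_measure_Ioc[of a b F] F(1) cont assms(3) by (auto simp: mono_def)
  qed auto
qed

lemma continuous_of_monotone_unit_lipschitz: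
  fixes F :: "real \<Rightarrow> real"
  assumes F: "mono F" and G: "mono (\<lambda>t. t - F t)"
  shows "continuous_on UNIV F"
proof -
  have "1-lipschitz_on UNIV F"
  proof (rule lipschitz_onI)
    fix x y
    show "dist (F x) (F y) \<le> 1 * dist x y"
      using monoD[OF F, of x y] monoD[OF F, of y x] monoD[OF G, of x y] monoD[OF G, of y x]
      by (cases "x \<le> y") (auto simp: dist_real_def)
  qed simp
  then show ?thesis by (rule lipschitz_on_continuous_on)
qed

text \<open>
  The two Stieltjes measures add up to the Stieltjes measure of the identity. In particular both
  are absolutely continuous, and their densities add up to \<open>1\<close>.
\<close>

lemma lborel_eq_sum_interval_measures:
  fixes F :: "real \<Rightarrow> real"
  assumes F: "mono F" and G: "mono (\<lambda>t. t - F t)" and A: "A \<in> sets borel"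
  shows "emeasure lborel A = emeasure (interval_measure F) A + emeasure (interval_measure (\<lambda>t. t - F t)) A"
proof -
  let ?M = "interval_measure F" and ?N = "interval_measure (\<lambda>t. t - F t)"
  have cF: "continuous_on UNIV F" using continuous_of_monotone_unit_lipschitz[OF F G] .
  then have cG: "continuous_on UNIV (\<lambda>t. t - F t)" by (intro continuous_intros)
  define K where "K = measure_of UNIV (sets borel) (\<lambda>A. emeasure ?M A + emeasure ?N A)"
  have K: "emeasure K A = emeasure ?M A + emeasure ?N A" if "A \<in> sets borel" for A
  proof -
    have ms: "measure_space UNIV (sets borel) (\<lambda>A. emeasure ?M A + emeasure ?N A)"
      unfolding measure_space_def
    proof (intro conjI)
      show "sigma_algebra UNIV (sets (borel::real measure))"
        using sets.sigma_algebra_axioms[of "borel::real measure"] by simp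
      show "positive (sets borel) (\<lambda>A. emeasure ?M A + emeasure ?N A)"
        by (simp add: positive_def)
      show "countably_additive (sets borel) (\<lambda>A. emeasure ?M A + emeasure ?N A)"
        unfolding countably_additive_def
        by (auto simp: suminf_emeasure suminf_add[symmetric])
    qed
    then show ?thesis
      unfolding K_def using that by (intro emeasure_measure_of_sigma) (auto simp: measure_space_def)
  qed
  have setsK: "sets K = sets borel"
    unfolding K_def using sets.sigma_sets_eq[of "borel::real measure"] sets.sets_into_space by auto
  have "lborel = K"
  proof (rule lborel_eqI)
    fix l u :: real
    assume "\<And>b. b \<in> Basis \<Longrightarrow> l \<bullet> b \<le> u \<bullet> b"
    then have lu: "l \<le> u" by auto
    have "emeasure K (box l u) = ennreal (F u - F l) + ennreal ((u - F u) - (l - F l))"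
      using lu by (simp add: K box_real emeasure_interval_measure_Ioo F G cF cG del: greaterThanLessThan_iff)
    also have "\<dots> = ennreal (u - l)"
      using monoD[OF F lu] monoD[OF G lu] by (subst ennreal_plus[symmetric]) auto
    finally show "emeasure K (box l u) = (\<Prod>b\<in>Basis. (u - l) \<bullet> b)" by simp
  qed (simp add: setsK)
  then show ?thesis using K A by simp
qed

text \<open>
  A Radon-Nikodym density of the Stieltjes measure of \<open>F\<close> serves as its derivative. Its
  bound by \<open>1\<close> comes from the complementary density of \<open>t - F t\<close>.
\<close>

lemma density_of_monotone_unit_lipschitz:
  fixes F :: "real \<Rightarrow> real"
  assumes F: "mono F" and G: "mono (\<lambda>t. t - F t)"
  shows "\<exists>f. f \<in> borel_measurable borel \<and> (\<forall>t. 0 \<le> f t \<and> f t \<le> 1) \<and>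
             (\<forall>a b. a \<le> b \<longrightarrow> (f has_integral (F b - F a)) {a..b})"
proof -
  let ?M = "interval_measure F" and ?N = "interval_measure (\<lambda>t. t - F t)"
  have sum: "emeasure lborel A = emeasure ?M A + emeasure ?N A" if "A \<in> sets borel" for A
    using lborel_eq_sum_interval_measures[OF F G that] .
  have "absolutely_continuous lborel ?M" "absolutely_continuous lborel ?N"
    unfolding absolutely_continuous_def null_sets_def using sum by auto
  then obtain f g where fg[measurable]: "f \<in> borel_measurable borel" "g \<in> borel_measurable borel"
    and df: "density lborel f = ?M" and dg: "density lborel g = ?N"
    using sigma_finite_measure.Radon_Nikodym[OF sigma_finite_lborel, of ?M] sigma_finite_measure.Radon_Nikodym[OF sigma_finite_lborel, of ?N] by auto
  have "density lborel (\<lambda>x. f x + g x) = density lborel (\<lambda>x. 1)"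
  proof (rule measure_eqI)
    fix A assume "A \<in> sets (density lborel (\<lambda>x. f x + g x))"
    then have A[measurable]: "A \<in> sets borel" by simp
    have "emeasure (density lborel (\<lambda>x. f x + g x)) A
        = emeasure (density lborel f) A + emeasure (density lborel g) A"
      by (simp add: emeasure_density distrib_right nn_integral_add)
    then show "emeasure (density lborel (\<lambda>x. f x + g x)) A = emeasure (density lborel (\<lambda>x. 1)) A"
      using sum[OF A] by (simp add: df dg emeasure_density)
  qed simp
  then have "AE x in lborel. f x + g x = 1"
    by (subst (asm) sigma_finite_measure.density_unique_iff[OF sigma_finite_lborel]) auto
  then have AE: "AE x in lborel. f x = ennreal (enn2real (min (f x) 1))"
  proof eventually_elim
    case (elim x)
    then have "f x \<le> 1" by (metis le_iff_add)
    then show ?case by (cases "f x") (auto simp: min_def top_unique)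
  qed
  \<comment> \<open>A real-valued version of the density with the bounds valid everywhere.\<close>
  define h where "h x = enn2real (min (f x) 1)" for x
  have h[measurable]: "h \<in> borel_measurable borel" unfolding h_def by measurable
  have h01: "0 \<le> h t" "h t \<le> 1" for t
    unfolding h_def using enn2real_mono[of "min (f t) 1" 1] by auto
  have cont: "continuous_on UNIV F" using continuous_of_monotone_unit_lipschitz[OF F G] .
  have "(h has_integral (F b - F a)) {a..b}" if ab: "a \<le> b" for a b
  proof -
    have "(\<integral>\<^sup>+x. ennreal (h x * indicator {a..b} x) \<partial>lborel) = (\<integral>\<^sup>+x. f x * indicator {a..b} x \<partial>lborel)"
      using AE by (intro nn_integral_cong_AE) (auto simp: h_def indicator_def elim!: eventually_mono)
    also have "\<dots> = emeasure ?M {a..b}"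
      by (simp add: df[symmetric] emeasure_density)
    also have "\<dots> = ennreal (F b - F a)"
      using emeasure_interval_measure_Icc[of a b F] F ab cont
      by (auto simp: mono_def intro: continuous_on_subset)
    finally have eq: "(\<integral>\<^sup>+x. ennreal (h x * indicator {a..b} x) \<partial>lborel) = ennreal (F b - F a)" .
    have "((\<lambda>x. h x * indicator {a..b} x) has_integral (F b - F a)) UNIV"
      using monoD[OF F ab] h01 eq by (intro nn_integral_has_integral) auto
    moreover have "(\<lambda>x. h x * indicator {a..b} x) = (\<lambda>x. if x \<in> {a..b} then h x else 0)"
      by (auto simp: indicator_def)
    ultimately show ?thesis using has_integral_restrict_UNIV[of "{a..b}" h] by simp
  qed
  then show ?thesis using h h01 by blast
qed

lemma AE_zero_of_integral_zero:
  fixes f :: "real \<Rightarrow> real"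
  assumes f[measurable]: "f \<in> borel_measurable borel" and nonneg: "\<And>t. 0 \<le> f t"
    and zero: "(f has_integral 0) {a..b}"
  shows "AE t in lebesgue. t \<in> {a..b} \<longrightarrow> f t = 0"
proof -
  have "((\<lambda>t. if t \<in> {a..b} then f t else 0) has_integral 0) UNIV"
    using zero by (simp only: has_integral_restrict_UNIV)
  then have "(\<integral>\<^sup>+t. ennreal (if t \<in> {a..b} then f t else 0) \<partial>lborel) = ennreal 0"
    using nonneg by (intro nn_integral_has_integral_lborel) auto
  then have "AE t in lborel. ennreal (if t \<in> {a..b} then f t else 0) = 0"
    by (subst (asm) ennreal_0, subst (asm) nn_integral_0_iff_AE) auto
  then have "AE t in lborel. t \<in> {a..b} \<longrightarrow> f t = 0"
    by eventually_elim (use nonneg in \<open>auto simp: ennreal_eq_0_iff antisym split: if_splits\<close>)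
  then show ?thesis by (rule AE_completion)
qed

text \<open>
  On an interval where \<open>F\<close> is constant, or grows at the full rate \<open>1\<close>, a density with values
  in \<open>{0..1}\<close> must take that extreme value almost everywhere. Intervals with rational endpoints
  suffice, and there are countably many of them.
\<close>

lemma density_of_monotone_unit_lipschitz_extreme:
  fixes F :: "real \<Rightarrow> real"
  assumes F: "mono F" and G: "mono (\<lambda>t. t - F t)"
  shows "\<exists>f. f \<in> borel_measurable borel \<and> (\<forall>t. 0 \<le> f t \<and> f t \<le> 1) \<and>
             (\<forall>a b. a \<le> b \<longrightarrow> (f has_integral (F b - F a)) {a..b}) \<and>
             (AE t in lebesgue. (\<exists>p q. p < t \<and> t < q \<and> F q = F p) \<longrightarrow> f t = 0) \<and>
             (AE t in lebesgue. (\<exists>p q. p < t \<and> t < q \<and> F q - F p = q - p) \<longrightarrow> f t = 1)"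
proof -
  obtain f where f: "f \<in> borel_measurable borel" and f01: "\<And>t. 0 \<le> f t" "\<And>t. f t \<le> 1"
    and int: "\<And>a b. a \<le> b \<Longrightarrow> (f has_integral (F b - F a)) {a..b}"
    using density_of_monotone_unit_lipschitz[OF F G] by blast
  have flat: "AE t in lebesgue. t \<in> {a..b} \<longrightarrow> f t = 0" if "a \<le> b" "F b = F a" for a b
    using int[OF that(1)] f f01 that(2) by (intro AE_zero_of_integral_zero) auto
  have steep: "AE t in lebesgue. t \<in> {a..b} \<longrightarrow> f t = 1" if "a \<le> b" "F b - F a = b - a" for a b
  proof -
    have "((\<lambda>t. 1 - f t) has_integral ((b - a) - (F b - F a))) {a..b}"
      using has_integral_diff[OF has_integral_const_real[of 1 a b] int[OF that(1)]] that(1) by simp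
    then have "AE t in lebesgue. t \<in> {a..b} \<longrightarrow> 1 - f t = 0"
      using f f01(2) that(2) by (intro AE_zero_of_integral_zero) auto
    then show ?thesis by eventually_elim auto
  qed
  have "AE t in lebesgue. \<forall>a\<in>\<rat>. \<forall>b\<in>\<rat>. a \<le> b \<and> F b = F a \<longrightarrow> t \<in> {a..b} \<longrightarrow> f t = 0"
    unfolding AE_ball_countable[OF countable_rat]
  proof (intro ballI)
    fix a b
    show "AE t in lebesgue. a \<le> b \<and> F b = F a \<longrightarrow> t \<in> {a..b} \<longrightarrow> f t = 0"
      using flat[of a b] by (cases "a \<le> b \<and> F b = F a") auto
  qed
  moreover have "AE t in lebesgue. \<forall>a\<in>\<rat>. \<forall>b\<in>\<rat>. a \<le> b \<and> F b - F a = b - a \<longrightarrow> t \<in> {a..b} \<longrightarrow> f t = 1"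
    unfolding AE_ball_countable[OF countable_rat]
  proof (intro ballI)
    fix a b
    show "AE t in lebesgue. a \<le> b \<and> F b - F a = b - a \<longrightarrow> t \<in> {a..b} \<longrightarrow> f t = 1"
      using steep[of a b] by (cases "a \<le> b \<and> F b - F a = b - a") auto
  qed
  ultimately have "AE t in lebesgue. ((\<exists>p q. p < t \<and> t < q \<and> F q = F p) \<longrightarrow> f t = 0) \<and>
     ((\<exists>p q. p < t \<and> t < q \<and> F q - F p = q - p) \<longrightarrow> f t = 1)"
  proof eventually_elim
    case (elim t)
    have approx: "\<exists>a\<in>\<rat>. \<exists>b\<in>\<rat>. p < a \<and> a < t \<and> t < b \<and> b < q" if "p < t" "t < q" for p q
      using Rats_dense_in_real[OF that(1)] Rats_dense_in_real[OF that(2)] by blast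
    show ?case
    proof (intro conjI impI; elim exE conjE)
      fix p q assume pq: "p < t" "t < q" and eq: "F q = F p"
      obtain a b where ab: "a \<in> \<rat>" "b \<in> \<rat>" "p < a" "a < t" "t < b" "b < q"
        using approx[OF pq] by blast
      have "F p \<le> F a" "F a \<le> F b" "F b \<le> F q" using ab by (auto intro!: monoD[OF F])
      then have "F b = F a" using eq by simp
      then show "f t = 0" using elim(1) ab by auto
    next
      fix p q assume pq: "p < t" "t < q" and eq: "F q - F p = q - p"
      obtain a b where ab: "a \<in> \<rat>" "b \<in> \<rat>" "p < a" "a < t" "t < b" "b < q"
        using approx[OF pq] by blast
      have "p - F p \<le> a - F a" "a - F a \<le> b - F b" "b - F b \<le> q - F q"
        using ab monoD[OF G, of p a] monoD[OF G, of a b] monoD[OF G, of b q] by auto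
      then have "F b - F a = b - a" using eq by simp
      then show "f t = 1" using elim(2) ab by auto
    qed
  qed
  then have "AE t in lebesgue. (\<exists>p q. p < t \<and> t < q \<and> F q = F p) \<longrightarrow> f t = 0"
    "AE t in lebesgue. (\<exists>p q. p < t \<and> t < q \<and> F q - F p = q - p) \<longrightarrow> f t = 1"
    by (auto elim!: eventually_mono)
  then show ?thesis using f f01 int by blast
qed

text \<open>
  A level set has at most one point without a point of the set to its left, and at most one
  without a point of the set to its right.
\<close>

lemma AE_level_set_two_sided:
  fixes x :: "real \<Rightarrow> 'a"
  shows "AE t in lebesgue. x t = y \<longrightarrow> (\<exists>p q. p < t \<and> t < q \<and> x p = y \<and> x q = y)"
proof -
  let ?L = "{t. x t = y \<and> (\<forall>p<t. x p \<noteq> y)}" and ?R = "{t. x t = y \<and> (\<forall>q>t. x q \<noteq> y)}"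
  have single: "negligible S" if "\<And>s t. s \<in> S \<Longrightarrow> t \<in> S \<Longrightarrow> s = t" for S :: "real set"
  proof (cases "S = {}")
    case False
    then obtain a where "a \<in> S" by blast
    then have "S = {a}" using that by blast
    then show ?thesis by simp
  qed simp
  have "negligible ?L" by (rule single) (metis (mono_tags, lifting) linorder_neqE mem_Collect_eq)
  moreover have "negligible ?R" by (rule single) (metis (mono_tags, lifting) linorder_neqE mem_Collect_eq)
  ultimately have "?L \<union> ?R \<in> null_sets lebesgue"
    by (simp add: negligible_iff_null_sets[symmetric])
  then have "AE t in lebesgue. t \<notin> ?L \<union> ?R" by (rule AE_not_in)
  then show ?thesis by eventually_elim blast
qed

section \<open>Velocities on the capacity surface\<close>

text \<open>
  \<open>A\<close> is the set of free coordinates of the box; its vertices choose \<open>lo\<close> on \<open>P\<close> and \<open>hi\<close>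
  on the rest of \<open>A\<close>. Each induction step writes \<open>v\<close> as a convex combination in one more
  coordinate.
\<close>

lemma convex_contains_box_of_vertices:
  fixes C :: "(real^'n::finite) set" and lo hi v :: "real^'n"
  assumes C: "convex C" and "finite A"
    and "\<And>P. P \<subseteq> A \<Longrightarrow> (\<chi> i. if i \<in> P then lo $ i else if i \<in> A then hi $ i else v $ i) \<in> C"
    and "\<And>i. i \<in> A \<Longrightarrow> lo $ i \<le> v $ i \<and> v $ i \<le> hi $ i"
  shows "v \<in> C"
  using assms(2-)
proof (induction A arbitrary: v)
  case empty
  from empty(1)[of "{}"] show ?case by (simp add: vec_lambda_eta)
next
  case (insert a A)
  define set_a where "set_a y = (\<chi> i. if i = a then y else v $ i)" for y :: real
  have lo_in: "set_a (lo $ a) \<in> C"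
  proof (rule insert.IH)
    fix P assume "P \<subseteq> A"
    then have "(\<chi> i. if i \<in> P then lo $ i else if i \<in> A then hi $ i else set_a (lo $ a) $ i)
        = (\<chi> i. if i \<in> insert a P then lo $ i else if i \<in> insert a A then hi $ i else v $ i)"
      using insert.hyps by (auto simp: vec_eq_iff set_a_def)
    then show "(\<chi> i. if i \<in> P then lo $ i else if i \<in> A then hi $ i else set_a (lo $ a) $ i) \<in> C"
      using insert.prems(1)[of "insert a P"] \<open>P \<subseteq> A\<close> by auto
  qed (use insert in \<open>auto simp: set_a_def\<close>)
  have hi_in: "set_a (hi $ a) \<in> C"
  proof (rule insert.IH)
    fix P assume "P \<subseteq> A"
    then have "(\<chi> i. if i \<in> P then lo $ i else if i \<in> A then hi $ i else set_a (hi $ a) $ i)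
        = (\<chi> i. if i \<in> P then lo $ i else if i \<in> insert a A then hi $ i else v $ i)"
      using insert.hyps by (auto simp: vec_eq_iff set_a_def)
    then show "(\<chi> i. if i \<in> P then lo $ i else if i \<in> A then hi $ i else set_a (hi $ a) $ i) \<in> C"
      using insert.prems(1)[of P] \<open>P \<subseteq> A\<close> by auto
  qed (use insert in \<open>auto simp: set_a_def\<close>)
  have "v $ a \<in> closed_segment (lo $ a) (hi $ a)"
    using insert.prems(2)[of a] by (simp add: closed_segment_eq_real_ivl)
  then obtain s where s: "0 \<le> s" "s \<le> 1" "v $ a = (1 - s) * lo $ a + s * hi $ a"
    by (auto simp: in_segment)
  have "v = (1 - s) *\<^sub>R set_a (lo $ a) + s *\<^sub>R set_a (hi $ a)"
    using s(3) by (auto simp: vec_eq_iff set_a_def algebra_simps)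
  then show ?case using convexD[OF C lo_in hi_in, of "1 - s" s] s by simp
qed

text \<open>
  Let \<open>A\<close> be the set of links whose flow equals the capacity and whose weight exceeds the lower
  bound. Outside \<open>A\<close> the controller prescribes \<open>v\<close>; on \<open>A\<close> all velocities between \<open>-rate\<close>
  and \<open>0\<close> are possible independently of each other. To realise a vertex of that box, the links
  in a subset \<open>P\<close> of \<open>A\<close> are to be overloaded slightly while the others keep their state. This
  is done by increasing the weights on \<open>P\<close> and taking the same amount from one link \<open>k\<close>
  outside \<open>A\<close>, so that the total weight, and with it the flow on all other links, does not
  change. Such a \<open>k\<close> exists, since otherwise every flow would equal its capacity, and the supply
  would be the sum of all capacities.
\<close>

lemma krasovskii_u1_contains:
  fixes x v c wl rate :: "real^'n::finite"
  assumes rate: "\<And>i. 0 < rate $ i" and c: "\<And>i. 0 < c $ i" and x: "\<And>i. 0 < x $ i"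
    and \<beta>: "0 < \<beta>" "\<beta> \<noteq> (\<Sum>i\<in>UNIV. c $ i)"
    and bounds: "\<And>i. - (rate $ i) \<le> v $ i \<and> v $ i \<le> 0"
    and idle: "\<And>i. x $ i \<le> wl $ i \<or> flow \<beta> x $ i < c $ i \<Longrightarrow> v $ i = 0"
    and active: "\<And>i. wl $ i < x $ i \<Longrightarrow> c $ i < flow \<beta> x $ i \<Longrightarrow> v $ i = - (rate $ i)"
  shows "v \<in> krasovskii (closed_loop (u1 rate c wl) \<beta>) x"
proof -
  let ?X = "closed_loop (u1 rate c wl) \<beta>" and ?S = "\<Sum>j\<in>UNIV. x $ j"
  define A where "A = {i. wl $ i < x $ i \<and> flow \<beta> x $ i = c $ i}"
  have S: "0 < ?S" using x by (intro sum_pos) auto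
  have "A \<noteq> UNIV"
  proof
    assume "A = UNIV"
    then have "flow \<beta> x $ i = c $ i" for i unfolding A_def by blast
    then have "(\<Sum>i\<in>UNIV. c $ i) = (\<Sum>i\<in>UNIV. flow \<beta> x $ i)" by simp
    also have "\<dots> = \<beta>"
      using S by (simp add: flow_def flip: sum_divide_distrib sum_distrib_left)
    finally show False using \<beta>(2) by simp
  qed
  then obtain k where k: "k \<notin> A" by blast
  have vertex: "\<exists>y\<in>ball x \<delta>. ?X y = (\<chi> i. if i \<in> P then - rate $ i else if i \<in> A then 0 else v $ i)"
    if \<delta>: "0 < \<delta>" and P: "P \<subseteq> A" for \<delta> P
  proof -
    let ?D = "\<Sum>i\<in>P. c $ i"
    define d :: "real^'n" where "d = (\<chi> j. (if j \<in> P then c $ j else 0) - (if j = k then ?D else 0))"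
    have kP: "k \<notin> P" using k P by blast
    have D: "0 \<le> ?D" using c by (intro sum_nonneg) (simp add: less_imp_le)
    have sum_d: "(\<Sum>j\<in>UNIV. d $ j) = 0"
      by (simp add: d_def sum_subtractf sum.If_cases)
    have "((\<lambda>\<epsilon>. \<epsilon> * norm d) \<longlongrightarrow> 0 * norm d) (at_right 0)"
      "((\<lambda>\<epsilon>. x $ k - \<epsilon> * ?D) \<longlongrightarrow> x $ k - 0 * ?D) (at_right 0)"
      "((\<lambda>\<epsilon>. \<beta> * (x $ k - \<epsilon> * ?D) / ?S) \<longlongrightarrow> \<beta> * (x $ k - 0 * ?D) / ?S) (at_right 0)"
      using S by (intro tendsto_intros; simp)+
    then have lims: "((\<lambda>\<epsilon>. \<epsilon> * norm d) \<longlongrightarrow> 0) (at_right 0)"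
      "((\<lambda>\<epsilon>. x $ k - \<epsilon> * ?D) \<longlongrightarrow> x $ k) (at_right 0)"
      "((\<lambda>\<epsilon>. \<beta> * (x $ k - \<epsilon> * ?D) / ?S) \<longlongrightarrow> flow \<beta> x $ k) (at_right 0)"
      by (simp_all add: flow_def)
    \<comment> \<open>Decreasing link \<open>k\<close> cannot switch its controller on, and a small decrease does not switch it off.\<close>
    have "\<forall>\<^sub>F \<epsilon> in at_right 0. wl $ k < x $ k \<longrightarrow> wl $ k < x $ k - \<epsilon> * ?D"
      using order_tendstoD(1)[OF lims(2), of "wl $ k"] by (cases "wl $ k < x $ k") auto
    moreover have "\<forall>\<^sub>F \<epsilon> in at_right 0. c $ k < flow \<beta> x $ k \<longrightarrow> c $ k < \<beta> * (x $ k - \<epsilon> * ?D) / ?S"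
      using order_tendstoD(1)[OF lims(3), of "c $ k"] by (cases "c $ k < flow \<beta> x $ k") auto
    moreover have "\<forall>\<^sub>F \<epsilon> in at_right 0. \<epsilon> * norm d < \<delta>"
      using order_tendstoD(2)[OF lims(1) \<delta>] .
    moreover have "\<forall>\<^sub>F \<epsilon> in at_right 0. (0::real) < \<epsilon>" by (rule eventually_at_right_less)
    ultimately have "\<forall>\<^sub>F \<epsilon> in at_right 0. 0 < \<epsilon> \<and> \<epsilon> * norm d < \<delta> \<and>
        (wl $ k < x $ k \<longrightarrow> wl $ k < x $ k - \<epsilon> * ?D) \<and>
        (c $ k < flow \<beta> x $ k \<longrightarrow> c $ k < \<beta> * (x $ k - \<epsilon> * ?D) / ?S)"
      by eventually_elim auto
    then obtain \<epsilon> where \<epsilon>: "0 < \<epsilon>" "\<epsilon> * norm d < \<delta>"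
        "wl $ k < x $ k \<Longrightarrow> wl $ k < x $ k - \<epsilon> * ?D"
        "c $ k < flow \<beta> x $ k \<Longrightarrow> c $ k < \<beta> * (x $ k - \<epsilon> * ?D) / ?S"
      using eventually_happens'[OF trivial_limit_at_right_real] by blast
    define y where "y = x + \<epsilon> *\<^sub>R d"
    have Sy: "(\<Sum>j\<in>UNIV. y $ j) = ?S"
      using sum_d by (simp add: y_def sum.distrib flip: sum_distrib_left)
    have flow_y: "flow \<beta> y $ i = \<beta> * y $ i / ?S" for i by (simp add: flow_def Sy)
    have flow_x: "flow \<beta> x $ i = \<beta> * x $ i / ?S" for i by (simp add: flow_def)
    have yk: "y $ k = x $ k - \<epsilon> * ?D" using kP by (simp add: y_def d_def)
    have "?X y $ i = (if i \<in> P then - rate $ i else if i \<in> A then 0 else v $ i)" for i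
    proof -
      consider "i \<in> P" | "i \<notin> P" "i \<in> A" | "i \<notin> A" "i \<noteq> k" | "i = k" using P by blast
      then show ?thesis
      proof cases
        case 1
        then have "y $ i = x $ i + \<epsilon> * c $ i" using kP by (auto simp: y_def d_def)
        then have less: "x $ i < y $ i" using \<epsilon>(1) c[of i] by simp
        then have "flow \<beta> x $ i < flow \<beta> y $ i"
          using S \<beta>(1) by (simp add: flow_x flow_y divide_strict_right_mono)
        then show ?thesis using 1 P less by (auto simp: closed_loop_def u1_def A_def)
      next
        case 2
        then have "y $ i = x $ i" using k by (auto simp: y_def d_def)
        then show ?thesis using 2 by (auto simp: closed_loop_def u1_def A_def flow_x flow_y)
      next
        case 3
        then have "y $ i = x $ i" using P by (auto simp: y_def d_def)
        then have same: "?X y $ i = u1 rate c wl i (x $ i) (flow \<beta> x $ i)"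
          by (simp add: closed_loop_def flow_x flow_y)
        have "v $ i = u1 rate c wl i (x $ i) (flow \<beta> x $ i)"
          using 3 idle[of i] active[of i] by (auto simp: u1_def A_def)
        then show ?thesis using 3 P same by auto
      next
        case 4
        have "\<epsilon> * ?D \<ge> 0" using \<epsilon>(1) D by simp
        then have le: "y $ k \<le> x $ k" "flow \<beta> y $ k \<le> flow \<beta> x $ k"
          using S \<beta>(1) by (auto simp: yk flow_x flow_y intro!: divide_right_mono)
        have "?X y $ k = v $ k"
        proof (cases "wl $ k < x $ k \<and> c $ k < flow \<beta> x $ k")
          case True
          then have "wl $ k < y $ k" "c $ k < flow \<beta> y $ k" using \<epsilon>(3,4) by (auto simp: yk flow_y)
          then show ?thesis using active[of k] True by (simp add: closed_loop_def u1_def)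
        next
          case False
          then have "x $ k \<le> wl $ k \<or> flow \<beta> x $ k < c $ k" using k by (auto simp: A_def)
          then show ?thesis using idle[of k] le by (auto simp: closed_loop_def u1_def)
        qed
        then show ?thesis using 4 k kP by auto
      qed
    qed
    then have "?X y = (\<chi> i. if i \<in> P then - rate $ i else if i \<in> A then 0 else v $ i)"
      by (simp add: vec_eq_iff)
    moreover have "y \<in> ball x \<delta>" using \<epsilon>(1,2) by (simp add: y_def dist_norm)
    ultimately show ?thesis by blast
  qed
  have "v \<in> convex hull (?X ` ball x \<delta>)" if "0 < \<delta>" for \<delta>
  proof (rule convex_contains_box_of_vertices[where A=A and lo="- rate" and hi=0])
    fix P assume "P \<subseteq> A"
    from vertex[OF that this] obtain y where y: "y \<in> ball x \<delta>"
      "?X y = (\<chi> i. if i \<in> P then - rate $ i else if i \<in> A then 0 else v $ i)" by blast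
    have "(\<chi> i. if i \<in> P then (- rate) $ i else if i \<in> A then 0 $ i else v $ i) = ?X y"
      using y(2) by (simp add: vec_eq_iff)
    then show "(\<chi> i. if i \<in> P then (- rate) $ i else if i \<in> A then 0 $ i else v $ i) \<in> convex hull (?X ` ball x \<delta>)"
      using y(1) by (simp only:) (intro hull_inc imageI)
  qed (use bounds in auto)
  then show ?thesis unfolding krasovskii_def using closure_subset by blast
qed

section \<open>A trajectory as least supersolution\<close>

text \<open>
  If \<open>w\<close> collects the current weights, this is the weight down to which link \<open>i\<close> may fall:
  the level at which its flow equals its capacity, but not below its lower bound, and not above
  its initial weight (a link that starts underloaded stays where it is).
\<close>

definition resting_weight ::
    "real^'n \<Rightarrow> real^'n \<Rightarrow> real \<Rightarrow> real^'n \<Rightarrow> real^'n::finite \<Rightarrow> real^'n" where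
  "resting_weight wl c \<beta> w0 w =
     (\<chi> i. max (wl $ i) (min (w0 $ i) (c $ i * (\<Sum>j\<in>UNIV. w $ j) / \<beta>)))"

text \<open>
  Functions that fall no faster than the controller can enforce and never fall below the resting
  weights that they themselves generate. Time ranges over all of \<open>real\<close>, with the initial
  weights imposed for \<open>t \<le> 0\<close>, so that the results on densities apply on the whole line.
\<close>

definition supersolutions ::
    "real^'n \<Rightarrow> real^'n \<Rightarrow> real^'n \<Rightarrow> real \<Rightarrow> real^'n::finite \<Rightarrow> (real \<Rightarrow> real^'n) set" where
  "supersolutions rate wl c \<beta> w0 = {g.
     (\<forall>s t i. s \<le> t \<longrightarrow> g t $ i \<le> g s $ i) \<and>
     (\<forall>s t i. s \<le> t \<longrightarrow> g s $ i - rate $ i * (t - s) \<le> g t $ i) \<and>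
     (\<forall>t i. resting_weight wl c \<beta> w0 (g t) $ i \<le> g t $ i) \<and>
     (\<forall>t\<le>0. \<forall>i. w0 $ i \<le> g t $ i)}"

text \<open>
  All defining conditions of supersolutions are preserved by pointwise infima, because resting
  weights are monotone; so the infimum is the least supersolution, as in the fixed point theorem
  of Knaster and Tarski.
\<close>

definition least_supersolution ::
    "real^'n \<Rightarrow> real^'n \<Rightarrow> real^'n \<Rightarrow> real \<Rightarrow> real^'n::finite \<Rightarrow> real \<Rightarrow> real^'n" where
  "least_supersolution rate wl c \<beta> w0 t =
     (\<chi> i. INF g\<in>supersolutions rate wl c \<beta> w0. g t $ i)"

lemma resting_weight_mono:
  fixes wl c w0 :: "real^'n::finite"
  assumes "\<And>i. 0 < c $ i" "0 < \<beta>" "\<And>i. x $ i \<le> y $ i"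
  shows "resting_weight wl c \<beta> w0 x $ i \<le> resting_weight wl c \<beta> w0 y $ i"
proof -
  have "c $ i * (\<Sum>j\<in>UNIV. x $ j) / \<beta> \<le> c $ i * (\<Sum>j\<in>UNIV. y $ j) / \<beta>"
    using assms by (intro divide_right_mono mult_left_mono sum_mono) (auto simp: less_imp_le)
  then show ?thesis by (auto simp: resting_weight_def)
qed

context
  fixes rate wl c w0 :: "real^'n::finite" and \<beta> :: real and w :: "real \<Rightarrow> real^'n"
  assumes wl: "\<And>i. 0 < wl $ i" and c: "\<And>i. 0 < c $ i" and rate: "\<And>i. 0 < rate $ i"
    and w0: "wl \<le> w0" and \<beta>: "0 < \<beta>"
  defines "w \<equiv> least_supersolution rate wl c \<beta> w0"
begin

lemma const_supersolution: "(\<lambda>_. w0) \<in> supersolutions rate wl c \<beta> w0"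
  using w0 rate by (auto simp: supersolutions_def resting_weight_def less_eq_vec_def less_imp_le)

lemma supersolution_ge_lower_bound:
  assumes "g \<in> supersolutions rate wl c \<beta> w0"
  shows "wl $ i \<le> g t $ i"
proof -
  have "wl $ i \<le> resting_weight wl c \<beta> w0 (g t) $ i" by (simp add: resting_weight_def)
  also have "\<dots> \<le> g t $ i" using assms by (simp add: supersolutions_def)
  finally show ?thesis .
qed

lemma least_supersolution_le:
  assumes "g \<in> supersolutions rate wl c \<beta> w0"
  shows "w t $ i \<le> g t $ i"
  using assms supersolution_ge_lower_bound
  by (auto simp: w_def least_supersolution_def intro!: cINF_lower bdd_belowI[of _ "wl $ i"])

lemma le_least_supersolution:
  assumes "\<And>g. g \<in> supersolutions rate wl c \<beta> w0 \<Longrightarrow> y \<le> g t $ i"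
  shows "y \<le> w t $ i"
  using assms const_supersolution
  by (auto simp: w_def least_supersolution_def intro!: cINF_greatest)

lemma least_supersolution_in: "w \<in> supersolutions rate wl c \<beta> w0"
proof -
  let ?G = "supersolutions rate wl c \<beta> w0"
  have "w t $ i \<le> w s $ i" if "s \<le> t" for s t i
  proof (rule le_least_supersolution)
    fix g assume g: "g \<in> ?G"
    have "w t $ i \<le> g t $ i" using least_supersolution_le[OF g] .
    also have "\<dots> \<le> g s $ i" using g that by (simp add: supersolutions_def)
    finally show "w t $ i \<le> g s $ i" .
  qed
  moreover have "w s $ i - rate $ i * (t - s) \<le> w t $ i" if "s \<le> t" for s t i
  proof (rule le_least_supersolution)
    fix g assume g: "g \<in> ?G"
    have "w s $ i - rate $ i * (t - s) \<le> g s $ i - rate $ i * (t - s)"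
      using least_supersolution_le[OF g] by simp
    also have "\<dots> \<le> g t $ i" using g that by (simp add: supersolutions_def)
    finally show "w s $ i - rate $ i * (t - s) \<le> g t $ i" .
  qed
  moreover have "resting_weight wl c \<beta> w0 (w t) $ i \<le> w t $ i" for t i
  proof (rule le_least_supersolution)
    fix g assume g: "g \<in> ?G"
    have "resting_weight wl c \<beta> w0 (w t) $ i \<le> resting_weight wl c \<beta> w0 (g t) $ i"
      using c \<beta> least_supersolution_le[OF g] by (intro resting_weight_mono) auto
    also have "\<dots> \<le> g t $ i" using g by (simp add: supersolutions_def)
    finally show "resting_weight wl c \<beta> w0 (w t) $ i \<le> g t $ i" .
  qed
  moreover have "w0 $ i \<le> w t $ i" if "t \<le> 0" for t i
    using that by (intro le_least_supersolution) (simp add: supersolutions_def)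
  ultimately show ?thesis unfolding supersolutions_def by blast
qed

lemma least_supersolution_antitone: "s \<le> t \<Longrightarrow> w t $ i \<le> w s $ i"
  and least_supersolution_slope: "s \<le> t \<Longrightarrow> w s $ i - rate $ i * (t - s) \<le> w t $ i"
  and least_supersolution_rest: "resting_weight wl c \<beta> w0 (w t) $ i \<le> w t $ i"
  and least_supersolution_start: "t \<le> 0 \<Longrightarrow> w0 $ i \<le> w t $ i"
  using least_supersolution_in unfolding supersolutions_def by blast+

text \<open>
  Minimality forces a link to fall at full rate as long as it is above its resting weight. To see
  this, let link \<open>i\<close> alone fall at full rate from time \<open>a\<close> on, stopping at the resting weight
  of time \<open>a\<close>. The result is again a supersolution: resting weights only decrease, both in
  time and when the weight of link \<open>i\<close> is lowered.
\<close>

lemma least_supersolution_descends: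
  assumes a: "0 \<le> a" "a \<le> t"
  shows "w t $ i \<le> max (w a $ i - rate $ i * (t - a)) (resting_weight wl c \<beta> w0 (w a) $ i)"
proof -
  let ?\<rho> = "resting_weight wl c \<beta> w0"
  define h where "h s = max (w a $ i - rate $ i * (s - a)) (?\<rho> (w a) $ i)" for s
  define g where "g s = (\<chi> j. if j = i \<and> a \<le> s then min (w s $ j) (h s) else w s $ j)" for s
  have g_le: "g s $ j \<le> w s $ j" for s j by (simp add: g_def)
  have g_other: "g s $ j = w s $ j" if "j \<noteq> i \<or> s < a" for s j using that by (auto simp: g_def)
  have g_after: "g s $ i = min (w s $ i) (h s)" if "a \<le> s" for s using that by (simp add: g_def)
  have h_antitone: "h t \<le> h s" if "s \<le> t" for s t
  proof -
    have "rate $ i * (s - a) \<le> rate $ i * (t - a)"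
      using that rate[of i] by (intro mult_left_mono) auto
    then show ?thesis by (auto simp: h_def)
  qed
  have h_slope: "h s - rate $ i * (t - s) \<le> h t" if "s \<le> t" for s t
  proof -
    have "0 \<le> rate $ i * (t - s)" using that rate[of i] by simp
    then show ?thesis by (auto simp: h_def max_def algebra_simps)
  qed
  have g_antitone: "g t $ j \<le> g s $ j" if "s \<le> t" for s t j
  proof (cases "j = i \<and> a \<le> s")
    case True
    then show ?thesis
      using that least_supersolution_antitone[OF that, of i] h_antitone[OF that]
      by (auto simp: g_after)
  next
    case False
    then have "g s $ j = w s $ j" using g_other[of j s] by (cases "j = i") auto
    then show ?thesis using g_le[of t j] least_supersolution_antitone[OF that, of j] by simp
  qed
  have g_slope: "g s $ j - rate $ j * (t - s) \<le> g t $ j" if "s \<le> t" for s t j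
  proof (cases "j = i \<and> a \<le> t")
    case True
    have wj: "w s $ i - rate $ i * (t - s) \<le> w t $ i" using least_supersolution_slope[OF that] .
    have "g s $ i - rate $ i * (t - s) \<le> h t"
    proof (cases "a \<le> s")
      case True
      then show ?thesis using h_slope[OF that] by (simp add: g_after)
    next
      case False
      have "w s $ i - rate $ i * (a - s) \<le> w a $ i"
        using least_supersolution_slope[of s a i] False by simp
      then have "w s $ i - rate $ i * (t - s) \<le> w a $ i - rate $ i * (t - a)"
        by (simp add: algebra_simps)
      then show ?thesis using False by (simp add: g_other h_def le_max_iff_disj)
    qed
    then show ?thesis using True wj g_le[of s i] by (auto simp: g_after)
  next
    case False
    then have "g t $ j = w t $ j" using g_other[of j t] by (cases "j = i") auto
    then show ?thesis using g_le[of s j] least_supersolution_slope[OF that, of j] by simp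
  qed
  have g_rest: "?\<rho> (g s) $ j \<le> g s $ j" for s j
  proof -
    have le: "?\<rho> (g s) $ j \<le> ?\<rho> (w s) $ j"
      using c \<beta> g_le by (intro resting_weight_mono) auto
    show ?thesis
    proof (cases "j = i \<and> a \<le> s")
      case True
      have "?\<rho> (w s) $ i \<le> ?\<rho> (w a) $ i"
        using c \<beta> least_supersolution_antitone True by (intro resting_weight_mono) auto
      then show ?thesis
        using le True least_supersolution_rest[of s i] by (auto simp: g_after h_def le_max_iff_disj)
    next
      case False
      then have "g s $ j = w s $ j" using g_other[of j s] by (cases "j = i") auto
      then show ?thesis using le least_supersolution_rest[of s j] by simp
    qed
  qed
  have g_start: "w0 $ j \<le> g s $ j" if "s \<le> 0" for s j
  proof (cases "j = i \<and> a \<le> s")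
    case True
    then have "s = a" using a that by simp
    then show ?thesis
      using True least_supersolution_start[OF that, of i] by (auto simp: g_after h_def le_max_iff_disj)
  next
    case False
    then have "g s $ j = w s $ j" using g_other[of j s] by (cases "j = i") auto
    then show ?thesis using least_supersolution_start[OF that] by simp
  qed
  have "g \<in> supersolutions rate wl c \<beta> w0"
    unfolding supersolutions_def using g_antitone g_slope g_rest g_start by blast
  from least_supersolution_le[OF this, of t i] show ?thesis
    using a by (simp add: g_after h_def)
qed

lemma least_supersolution_le_start: "w t $ i \<le> w0 $ i"
  using least_supersolution_le[OF const_supersolution] .

lemma least_supersolution_ge_lower_bound: "wl $ i \<le> w t $ i"
  using supersolution_ge_lower_bound[OF least_supersolution_in] .

lemma least_supersolution_isCont: "isCont (\<lambda>t. w t $ i) t"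
proof -
  have "(rate $ i)-lipschitz_on UNIV (\<lambda>t. w t $ i)"
  proof (rule lipschitz_onI)
    fix x y
    show "dist (w x $ i) (w y $ i) \<le> rate $ i * dist x y"
      using least_supersolution_antitone[of x y i] least_supersolution_slope[of x y i]
        least_supersolution_antitone[of y x i] least_supersolution_slope[of y x i]
      by (cases "x \<le> y") (auto simp: dist_real_def abs_if)
  qed (use rate in \<open>simp add: less_imp_le\<close>)
  then show ?thesis
    using lipschitz_on_continuous_on continuous_on_eq_continuous_at open_UNIV by blast
qed

text \<open>
  By continuity there are \<open>p < t < q\<close> such that the weight at \<open>q\<close> is still above the resting
  weight of time \<open>p\<close>. Then the maximum in \<open>least_supersolution_descends\<close> is its first argument.
\<close>

lemma least_supersolution_steep:
  assumes t: "0 < t" and above: "resting_weight wl c \<beta> w0 (w t) $ i < w t $ i"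
  shows "\<exists>p q. p < t \<and> t < q \<and> w q $ i = w p $ i - rate $ i * (q - p)"
proof -
  let ?\<rho> = "resting_weight wl c \<beta> w0"
  obtain z where z: "?\<rho> (w t) $ i < z" "z < w t $ i" using above dense by blast
  have "(w \<longlongrightarrow> w t) (at t)"
    using least_supersolution_isCont by (intro vec_tendstoI) (simp add: isCont_def)
  then have w_lim: "((\<lambda>s. w s $ i) \<longlongrightarrow> w t $ i) (at t)"
    and rest_lim: "((\<lambda>s. ?\<rho> (w s) $ i) \<longlongrightarrow> ?\<rho> (w t) $ i) (at t)"
    using \<beta> by (auto simp: resting_weight_def intro!: tendsto_intros)
  have "\<forall>\<^sub>F p in at_left t. ?\<rho> (w p) $ i < z"
    using order_tendstoD(2)[OF rest_lim z(1)] by (simp add: eventually_at_split)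
  moreover have "\<forall>\<^sub>F p in at_left t. p \<in> {0<..<t}" using t by (rule eventually_at_left_real)
  ultimately have "\<forall>\<^sub>F p in at_left t. ?\<rho> (w p) $ i < z \<and> 0 < p \<and> p < t"
    by eventually_elim auto
  then obtain p where p: "?\<rho> (w p) $ i < z" "0 < p" "p < t"
    using eventually_happens'[OF trivial_limit_at_left_real] by blast
  have "\<forall>\<^sub>F q in at_right t. z < w q $ i"
    using order_tendstoD(1)[OF w_lim z(2)] by (simp add: eventually_at_split)
  moreover have "\<forall>\<^sub>F q in at_right t. t < q" by (rule eventually_at_right_less)
  ultimately have "\<forall>\<^sub>F q in at_right t. z < w q $ i \<and> t < q" by eventually_elim auto
  then obtain q where q: "z < w q $ i" "t < q"
    using eventually_happens'[OF trivial_limit_at_right_real] by blast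
  have "w q $ i \<le> w p $ i - rate $ i * (q - p)"
    using least_supersolution_descends[of p q i] p q by auto
  moreover have "w p $ i - rate $ i * (q - p) \<le> w q $ i"
    using least_supersolution_slope[of p q i] p q by simp
  ultimately show ?thesis using p q by (intro exI[of _ p] exI[of _ q]) auto
qed

text \<open>
  The rescaled loss of weight \<open>- w t $ i / rate $ i\<close> is monotone with slope at most \<open>1\<close>, so it
  has a density with values in \<open>{0..1}\<close>. Almost everywhere this density is \<open>0\<close> on the
  level sets of \<open>wl $ i\<close> and \<open>w0 $ i\<close> (\<open>AE_level_set_two_sided\<close>), and \<open>1\<close> wherever the
  weight falls at full rate (\<open>least_supersolution_steep\<close>).
\<close>

lemma least_supersolution_component_velocity:
  "\<exists>v. (\<forall>t\<ge>0. (v has_integral (w t $ i - w 0 $ i)) {0..t}) \<and>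
       (\<forall>t. - (rate $ i) \<le> v t \<and> v t \<le> 0) \<and>
       (AE t in lebesgue. 0 < t \<longrightarrow>
         (w t $ i = wl $ i \<or> w t $ i = w0 $ i \<longrightarrow> v t = 0) \<and>
         (resting_weight wl c \<beta> w0 (w t) $ i < w t $ i \<longrightarrow> v t = - (rate $ i)))"
proof -
  let ?r = "rate $ i"
  have r: "0 < ?r" using rate .
  define F where "F t = - w t $ i / ?r" for t
  have "mono F"
    using least_supersolution_antitone r by (auto simp: F_def mono_def divide_right_mono)
  moreover have "mono (\<lambda>t. t - F t)"
  proof (rule monoI)
    fix x y :: real assume "x \<le> y"
    then have "(w x $ i - w y $ i) / ?r \<le> y - x"
      using least_supersolution_slope[of x y i] r by (simp add: pos_divide_le_eq mult.commute)
    then show "x - F x \<le> y - F y" by (simp add: F_def diff_divide_distrib)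
  qed
  ultimately obtain f where f01: "\<And>t. 0 \<le> f t" "\<And>t. f t \<le> 1"
    and int: "\<And>a b. a \<le> b \<Longrightarrow> (f has_integral (F b - F a)) {a..b}"
    and flat: "AE t in lebesgue. (\<exists>p q. p < t \<and> t < q \<and> F q = F p) \<longrightarrow> f t = 0"
    and steep: "AE t in lebesgue. (\<exists>p q. p < t \<and> t < q \<and> F q - F p = q - p) \<longrightarrow> f t = 1"
    using density_of_monotone_unit_lipschitz_extreme[of F] by blast
  have flat': "f t = 0" if "(\<exists>p q. p < t \<and> t < q \<and> F q = F p) \<longrightarrow> f t = 0"
    "\<exists>p q. p < t \<and> t < q \<and> w p $ i = y \<and> w q $ i = y" for t y
    using that by (auto simp: F_def)
  show ?thesis
  proof (intro exI[of _ "\<lambda>t. - ?r * f t"] conjI allI impI)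
    fix t :: real
    show "((\<lambda>t. - ?r * f t) has_integral (w t $ i - w 0 $ i)) {0..t}" if "0 \<le> t"
    proof -
      have "- ?r * (F t - F 0) = w t $ i - w 0 $ i" using r by (simp add: F_def field_simps)
      then show ?thesis using has_integral_mult_right[OF int[OF that], of "- ?r"] by simp
    qed
    show "- ?r \<le> - ?r * f t" "- ?r * f t \<le> 0" using f01[of t] r by (auto simp: mult_left_le)
  next
    show "AE t in lebesgue. 0 < t \<longrightarrow>
        (w t $ i = wl $ i \<or> w t $ i = w0 $ i \<longrightarrow> - ?r * f t = 0) \<and>
        (resting_weight wl c \<beta> w0 (w t) $ i < w t $ i \<longrightarrow> - ?r * f t = - ?r)"
      using flat steep AE_level_set_two_sided[of "\<lambda>t. w t $ i" "wl $ i"]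
        AE_level_set_two_sided[of "\<lambda>t. w t $ i" "w0 $ i"]
    proof eventually_elim
      case (elim t)
      show ?case
      proof (intro impI conjI)
        assume "w t $ i = wl $ i \<or> w t $ i = w0 $ i"
        then show "- ?r * f t = 0" using elim(3,4) flat'[OF elim(1)] by auto
      next
        assume "0 < t" "resting_weight wl c \<beta> w0 (w t) $ i < w t $ i"
        then obtain p q where pq: "p < t" "t < q" "w q $ i = w p $ i - ?r * (q - p)"
          using least_supersolution_steep by blast
        then have "F q - F p = q - p" using r by (simp add: F_def field_simps)
        then show "- ?r * f t = - ?r" using elim(2) pq by auto
      qed
    qed
  qed
qed

text \<open>
  At almost every time the velocity meets the requirements of \<open>krasovskii_u1_contains\<close>. An
  overloaded link above its lower bound is above its resting weight, hence falls at full rate. An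
  underloaded link has a weight below its capacity level but not below its resting weight, which is
  only possible if it is still at its initial weight; there, and at the lower bound, the velocity
  is \<open>0\<close>.
\<close>

lemma least_supersolution_trajectory:
  assumes generic: "\<beta> \<noteq> (\<Sum>i\<in>UNIV. c $ i)"
  shows "trajectory (u1 rate c wl) \<beta> w0 w"
proof -
  let ?X = "closed_loop (u1 rate c wl) \<beta>"
  have "\<forall>i. \<exists>v. (\<forall>t\<ge>0. (v has_integral (w t $ i - w 0 $ i)) {0..t}) \<and>
       (\<forall>t. - (rate $ i) \<le> v t \<and> v t \<le> 0) \<and>
       (AE t in lebesgue. 0 < t \<longrightarrow>
         (w t $ i = wl $ i \<or> w t $ i = w0 $ i \<longrightarrow> v t = 0) \<and>
         (resting_weight wl c \<beta> w0 (w t) $ i < w t $ i \<longrightarrow> v t = - (rate $ i)))"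
    using least_supersolution_component_velocity by blast
  then obtain V where
    int: "\<And>i t. 0 \<le> t \<Longrightarrow> (V i has_integral (w t $ i - w 0 $ i)) {0..t}" and
    bounds: "\<And>i t. - (rate $ i) \<le> V i t \<and> V i t \<le> 0" and
    ae: "\<And>i. AE t in lebesgue. 0 < t \<longrightarrow>
         (w t $ i = wl $ i \<or> w t $ i = w0 $ i \<longrightarrow> V i t = 0) \<and>
         (resting_weight wl c \<beta> w0 (w t) $ i < w t $ i \<longrightarrow> V i t = - (rate $ i))"
    unfolding choice_iff by blast
  define v where "v t = (\<chi> i. V i t)" for t
  have pos: "0 < w t $ i" for t i
    using wl[of i] least_supersolution_ge_lower_bound[of i t] by simp
  have "v absolutely_integrable_on {0..t} \<and> w t = w 0 + integral {0..t} v" if t: "0 \<le> t" for t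
  proof
    show "v absolutely_integrable_on {0..t}"
    proof (rule absolutely_integrable_componentwise)
      fix b :: "real^'n" assume "b \<in> Basis"
      then obtain i where b: "b = axis i 1" by (auto simp: Basis_vec_def)
      have "(\<lambda>s. - V i s) absolutely_integrable_on {0..t}"
        using int[OF t, of i] bounds
        by (intro nonnegative_absolutely_integrable_1 integrable_neg) auto
      from set_integrable_mult_right[OF this, of "- 1"]
      show "(\<lambda>s. v s \<bullet> b) absolutely_integrable_on {0..t}"
        by (simp add: b v_def inner_axis)
    qed
    have "(v has_integral (w t - w 0)) {0..t}"
    proof (subst has_integral_componentwise_iff, rule ballI)
      fix b :: "real^'n" assume "b \<in> Basis"
      then obtain i where b: "b = axis i 1" by (auto simp: Basis_vec_def)
      show "((\<lambda>s. v s \<bullet> b) has_integral (w t - w 0) \<bullet> b) {0..t}"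
        using int[OF t, of i] by (simp add: b v_def inner_axis)
    qed
    then show "w t = w 0 + integral {0..t} v" by (simp add: integral_unique)
  qed
  moreover have "AE t in lebesgue. 0 \<le> t \<longrightarrow> v t \<in> krasovskii ?X (w t)"
  proof -
    have "AE t in lebesgue. \<forall>i\<in>UNIV. 0 < t \<longrightarrow>
         (w t $ i = wl $ i \<or> w t $ i = w0 $ i \<longrightarrow> V i t = 0) \<and>
         (resting_weight wl c \<beta> w0 (w t) $ i < w t $ i \<longrightarrow> V i t = - (rate $ i))"
      using ae by (intro AE_finite_allI) auto
    moreover have "AE t in lebesgue. t \<notin> {0::real}"
      by (rule AE_not_in) (simp add: negligible_iff_null_sets[symmetric])
    ultimately show ?thesis
    proof eventually_elim
      case (elim t)
      show ?case
      proof
        assume "0 \<le> t"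
        then have t: "0 < t" using elim(2) by simp
        have zero: "V i t = 0" if "w t $ i = wl $ i \<or> w t $ i = w0 $ i" for i
          using elim(1) t that by blast
        have full: "V i t = - (rate $ i)" if "resting_weight wl c \<beta> w0 (w t) $ i < w t $ i" for i
          using elim(1) t that by blast
        let ?S = "\<Sum>j\<in>UNIV. w t $ j"
        have S: "0 < ?S" using pos by (intro sum_pos) auto
        have flow: "flow \<beta> (w t) $ i < c $ i \<longleftrightarrow> w t $ i < c $ i * ?S / \<beta>"
          "c $ i < flow \<beta> (w t) $ i \<longleftrightarrow> c $ i * ?S / \<beta> < w t $ i" for i
          using S \<beta> by (auto simp: flow_def field_simps)
        show "v t \<in> krasovskii ?X (w t)"
        proof (rule krasovskii_u1_contains[OF rate c pos \<beta> generic])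
          fix i
          show "- (rate $ i) \<le> v t $ i \<and> v t $ i \<le> 0" using bounds by (simp add: v_def)
          show "v t $ i = 0" if "w t $ i \<le> wl $ i \<or> flow \<beta> (w t) $ i < c $ i"
            using that
          proof
            assume "w t $ i \<le> wl $ i"
            then show ?thesis
              using least_supersolution_ge_lower_bound[of i t] zero by (simp add: v_def)
          next
            assume "flow \<beta> (w t) $ i < c $ i"
            then have "w0 $ i \<le> w t $ i"
              using least_supersolution_rest[of t i] by (auto simp: flow resting_weight_def)
            then show ?thesis
              using least_supersolution_le_start[of t i] zero by (simp add: v_def)
          qed
          show "v t $ i = - (rate $ i)" if "wl $ i < w t $ i" "c $ i < flow \<beta> (w t) $ i"
            using that full by (simp add: v_def flow resting_weight_def min_less_iff_disj)
        qed
      qed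
    qed
  qed
  moreover have "w 0 = w0"
    using least_supersolution_le_start[of 0] least_supersolution_start[of 0]
    by (auto simp: vec_eq_iff intro: antisym)
  ultimately show ?thesis
    using pos unfolding trajectory_def krasovskii_solution_def by blast
qed

end

section \<open>The margin of robustness\<close>

text \<open>
  For the upper bound the supply is chosen between the bound and a supposedly robust \<open>\<alpha>\<close>, and
  different from the total capacity, so that \<open>least_supersolution_trajectory\<close> provides a
  trajectory.
\<close>

lemma margin_of_robustness_u1:
  fixes wl c rate w0 :: "real^'n::finite"
  assumes wl: "\<And>i. 0 < wl $ i" and c: "\<And>i. 0 < c $ i" and rate: "\<And>i. 0 < rate $ i"
    and w0: "wl \<le> w0"
  shows "margin_of_robustness (u1 rate c wl) c w0 = ereal (throughput_bound (r_star wl c) c w0)"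
proof (rule antisym)
  let ?V = "throughput_bound (r_star wl c) c w0"
  have V: "0 < ?V"
  proof (rule throughput_bound_pos)
    show "0 < w0 $ i" for i
      using w0 wl[of i] unfolding less_eq_vec_def by (meson less_le_trans)
  qed (use r_star_pos wl c in auto)
  show "margin_of_robustness (u1 rate c wl) c w0 \<le> ereal ?V"
    unfolding margin_of_robustness_def
  proof (rule Sup_least, clarify, rule ccontr)
    fix \<alpha> assume \<alpha>: "0 \<le> \<alpha>"
      and robust: "\<forall>\<beta>\<in>{0..\<alpha>}. \<forall>w. trajectory (u1 rate c wl) \<beta> w0 w \<longrightarrow> feasible_limit c \<beta> w"
      and "\<not> ereal \<alpha> \<le> ereal ?V"
    then have "?V < \<alpha>" by simp
    obtain \<beta> where \<beta>: "?V < \<beta>" "\<beta> \<le> \<alpha>" "\<beta> \<noteq> (\<Sum>i\<in>UNIV. c $ i)"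
    proof (cases "\<alpha> = (\<Sum>i\<in>UNIV. c $ i)")
      case True
      then show ?thesis using that dense[OF \<open>?V < \<alpha>\<close>] by (metis less_imp_le order_less_irrefl)
    qed (use that[of \<alpha>] \<open>?V < \<alpha>\<close> in auto)
    have "0 < \<beta>" using V \<beta>(1) by simp
    have traj: "trajectory (u1 rate c wl) \<beta> w0 (least_supersolution rate wl c \<beta> w0)"
      using least_supersolution_trajectory[OF wl c rate w0 \<open>0 < \<beta>\<close> \<beta>(3)] .
    then have "feasible_limit c \<beta> (least_supersolution rate wl c \<beta> w0)"
      using robust \<beta> \<open>0 < \<beta>\<close> by auto
    from u1_feasible_limit_supply_le[OF wl c rate w0 traj this] \<beta>(1) show False by simp
  qed
  show "ereal ?V \<le> margin_of_robustness (u1 rate c wl) c w0"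
  proof (rule dense_le)
    fix x assume x: "x < ereal ?V"
    obtain \<alpha> where \<alpha>: "x \<le> ereal \<alpha>" "0 \<le> \<alpha>" "\<alpha> < ?V"
      using x V that[of "max 0 (real_of_ereal x)"] by (cases x) auto
    have "feasible_limit c \<beta> w"
      if "\<beta> \<in> {0..\<alpha>}" "trajectory (u1 rate c wl) \<beta> w0 w" for \<beta> w
      using u1_trajectory_feasible[OF wl c rate w0 that(2)] that(1) \<alpha>(3) by auto
    then have "ereal \<alpha> \<le> margin_of_robustness (u1 rate c wl) c w0"
      unfolding margin_of_robustness_def using \<alpha>(2) by (intro Sup_upper imageI) auto
    then show "x \<le> margin_of_robustness (u1 rate c wl) c w0" using \<alpha>(1) by simp
  qed
qed

theorem proposition9:
  fixes wl wu c rate w0 :: "real^'n::finite"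
    and p :: "nat \<Rightarrow> 'n"
  assumes "\<And>i. 0 < wl $ i" and "\<And>i. 0 < wu $ i" and "\<And>i. 0 < c $ i"
    and "\<And>i. 0 < rate $ i"
    and "wl \<le> w0" and "w0 \<le> wu"
    and "sorted_labelling w0 c p"
  shows "(margin_of_robustness (u1 rate c wl) c w0 = ereal (V_star wl c w0 p) \<and>
          ereal (V_star wl c w0 p) = alpha_star wl wu c)
         \<longleftrightarrow> w_opt wl wu c \<le> w0"
proof -
  let ?r = "r_star wl c"
  have margin: "margin_of_robustness (u1 rate c wl) c w0 = ereal (throughput_bound ?r c w0)"
    using margin_of_robustness_u1 assms(1,3,4,5) .
  have V: "V_star wl c w0 p = throughput_bound ?r c w0"
    using V_star_eq_throughput_bound assms(1,3,5,7) .
  have alpha: "alpha_star wl wu c = ereal (throughput_bound ?r c wu)"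
    using alpha_star_eq_throughput_bound[OF assms(1,3) order_trans[OF assms(5,6)]] .
  have "throughput_bound ?r c w0 = throughput_bound ?r c wu \<longleftrightarrow> w_opt wl wu c \<le> w0"
    using throughput_bound_eq_iff[OF r_star_pos[OF assms(1,3)] assms(6), of c]
    by (simp add: w_opt_def r_star_def less_eq_vec_def)
  then show ?thesis by (simp add: margin V alpha)
qed

end
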